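(* Let $G$ be a finitely generated virtually metanilpotent group. Then the subset of $\mathrm{Hom}_{\mathrm{irr}}(G, \mathrm{Homeo}_0(\mathbb{R}))$ consisting of all irreducible actions which are semi-conjugate to a non-abelian affine action is open.
   Context: A group $G$ is virtually metanilpotent if it admits a nilpotent normal subgroup $N$ such that $G/N$ is virtually nilpotent (equivalently, $G$ has a finite index subgroup $G_0$ with a normal subgroup $N\unlhd G_0$ such that $N$ and $G_0/N$ are nilpotent). $\mathrm{Homeo}_0(\mathbb{R})$ is the group of orientation-preserving homeomorphisms of $\mathbb{R}$, with the compact-open topology. An action $\varphi\colon G\to\mathrm{Homeo}_0(\mathbb{R})$ (a homomorphism) is irreducible if it has no global fixed point in $\mathbb{R}$. $\mathrm{Hom}_{\mathrm{irr}}(G,\mathrm{Homeo}_0(\mathbb{R}))$ is the space of irreducible actions, with the topology induced from the pointwise convergence topology on all maps $G\to\mathrm{Homeo}_0(\mathbb{R})$. Two irreducible actions $\varphi,\psi\colon G\to\mathrm{Homeo}_0(\mathbb{R})$ are semi-conjugate if there is a monotone map $h\colon\mathbb{R}\to\mathbb{R}$ (not necessarily continuous) with $h\circ\varphi(g)=\psi(g)\circ h$ for all $g\in G$. $\mathrm{Aff}(\mathbb{R})=\{x\mapsto ax+b : a>0,\ b\in\mathbb{R}\}$. An affine action is a homomorphism $\psi\colon G\to\mathrm{Aff}(\mathbb{R})$; it is non-abelian if its image is non-abelian. *)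

theory Defs
  imports "HOL-Analysis.Analysis" "HOL-Algebra.Algebra"
begin

definition finitely_generated_group :: "('a, 'b) monoid_scheme \<Rightarrow> bool" where
  "finitely_generated_group G \<longleftrightarrow>
     group G \<and> (\<exists>S. finite S \<and> S \<subseteq> carrier G \<and> generate G S = carrier G)"

fun lower_central_series :: "('a, 'b) monoid_scheme \<Rightarrow> nat \<Rightarrow> 'a set" where
  "lower_central_series G 0 = carrier G"
| "lower_central_series G (Suc n) =
     generate G (\<Union>x \<in> lower_central_series G n. \<Union>y \<in> carrier G.
       {x \<otimes>\<^bsub>G\<^esub> y \<otimes>\<^bsub>G\<^esub> inv\<^bsub>G\<^esub> x \<otimes>\<^bsub>G\<^esub> inv\<^bsub>G\<^esub> y})"

definition nilpotent_group :: "('a, 'b) monoid_scheme \<Rightarrow> bool" where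
  "nilpotent_group G \<longleftrightarrow> group G \<and> (\<exists>n. lower_central_series G n = {\<one>\<^bsub>G\<^esub>})"

definition virtually_nilpotent_group :: "('a, 'b) monoid_scheme \<Rightarrow> bool" where
  "virtually_nilpotent_group G \<longleftrightarrow> group G \<and>
     (\<exists>H. subgroup H G \<and> finite (rcosets\<^bsub>G\<^esub> H) \<and> nilpotent_group (G\<lparr>carrier := H\<rparr>))"

definition virtually_metanilpotent_group :: "('a, 'b) monoid_scheme \<Rightarrow> bool" where
  "virtually_metanilpotent_group G \<longleftrightarrow> group G \<and>
     (\<exists>N. N \<lhd> G \<and> nilpotent_group (G\<lparr>carrier := N\<rparr>) \<and> virtually_nilpotent_group (G Mod N))"

definition Homeo0 :: "(real \<Rightarrow> real) monoid" where
  "Homeo0 = \<lparr>carrier = {f. strict_mono f \<and> (\<exists>f'. homeomorphism UNIV UNIV f f')},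
             monoid.mult = (\<circ>), one = id\<rparr>"

definition Aff :: "(real \<Rightarrow> real) set" where
  "Aff = {\<lambda>x. a * x + b | a b. a > 0}"

definition compact_open_Homeo0 :: "(real \<Rightarrow> real) topology" where
  "compact_open_Homeo0 =
     topology_generated_by {{f \<in> carrier Homeo0. f ` K \<subseteq> U} | K U. compact K \<and> open U}"

text \<open>Actions are taken extensional outside the carrier of the group, so that they are points of
  the product topology indexed by the carrier.\<close>

definition Hom_irr :: "('a, 'b) monoid_scheme \<Rightarrow> ('a \<Rightarrow> real \<Rightarrow> real) set" where
  "Hom_irr G = {\<phi> \<in> hom G Homeo0 \<inter> extensional (carrier G).
     \<not> (\<exists>x. \<forall>g \<in> carrier G. \<phi> g x = x)}"

definition Hom_irr_topology :: "('a, 'b) monoid_scheme \<Rightarrow> ('a \<Rightarrow> real \<Rightarrow> real) topology" where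
  "Hom_irr_topology G =
     subtopology (product_topology (\<lambda>_. compact_open_Homeo0) (carrier G)) (Hom_irr G)"

text \<open>Monotone maps may be non-decreasing or non-increasing.\<close>

definition semi_conjugate ::
    "('a, 'b) monoid_scheme \<Rightarrow> ('a \<Rightarrow> real \<Rightarrow> real) \<Rightarrow> ('a \<Rightarrow> real \<Rightarrow> real) \<Rightarrow> bool" where
  "semi_conjugate G \<phi> \<psi> \<longleftrightarrow> \<phi> \<in> Hom_irr G \<and> \<psi> \<in> Hom_irr G \<and>
     (\<exists>h :: real \<Rightarrow> real. (mono h \<or> antimono h) \<and> (\<forall>g \<in> carrier G. h \<circ> \<phi> g = \<psi> g \<circ> h))"

definition nonabelian_affine_action ::
    "('a, 'b) monoid_scheme \<Rightarrow> ('a \<Rightarrow> real \<Rightarrow> real) \<Rightarrow> bool" where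
  "nonabelian_affine_action G \<psi> \<longleftrightarrow>
     \<psi> \<in> hom G (Homeo0\<lparr>carrier := Aff\<rparr>) \<and>
     (\<exists>f \<in> \<psi> ` carrier G. \<exists>f' \<in> \<psi> ` carrier G. f \<circ> f' \<noteq> f' \<circ> f)"

lemma group_Homeo0: "group Homeo0"
proof (rule groupI)
  fix f g assume "f \<in> carrier Homeo0" "g \<in> carrier Homeo0"
  then obtain f' g' where fg: "strict_mono f" "strict_mono g"
      "homeomorphism UNIV UNIV f f'" "homeomorphism UNIV UNIV g g'"
    by (auto simp: Homeo0_def)
  have "strict_mono (f \<circ> g)"
    using fg(1,2) by (simp add: strict_mono_def)
  moreover have "homeomorphism UNIV UNIV (f \<circ> g) (g' \<circ> f')"
    using fg(4,3) by (rule homeomorphism_compose)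
  ultimately show "f \<otimes>\<^bsub>Homeo0\<^esub> g \<in> carrier Homeo0"
    unfolding Homeo0_def by simp blast
next
  have "strict_mono (id :: real \<Rightarrow> real)"
    by (simp add: strict_mono_def)
  moreover have "homeomorphism UNIV UNIV (id :: real \<Rightarrow> real) id"
    by (simp add: homeomorphism_def)
  ultimately show "\<one>\<^bsub>Homeo0\<^esub> \<in> carrier Homeo0"
    unfolding Homeo0_def by simp blast
next
  fix f assume "f \<in> carrier Homeo0"
  then obtain f' where f: "strict_mono f" "homeomorphism UNIV UNIV f f'"
    by (auto simp: Homeo0_def)
  have inv: "f' (f x) = x" "f (f' x) = x" for x
    using f(2) by (simp_all add: homeomorphism_def)
  have "strict_mono f'"
  proof (rule strict_monoI)
    fix x y :: real assume "x < y"
    then have "f (f' x) < f (f' y)" by (simp only: inv)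
    then show "f' x < f' y" by (simp only: strict_mono_less[OF f(1)])
  qed
  moreover have "homeomorphism UNIV UNIV f' f"
    using f(2) by (rule homeomorphism_symD)
  ultimately have "f' \<in> carrier Homeo0"
    unfolding Homeo0_def by simp blast
  moreover have "f' \<otimes>\<^bsub>Homeo0\<^esub> f = \<one>\<^bsub>Homeo0\<^esub>"
    by (simp add: Homeo0_def fun_eq_iff inv)
  ultimately show "\<exists>g \<in> carrier Homeo0. g \<otimes>\<^bsub>Homeo0\<^esub> f = \<one>\<^bsub>Homeo0\<^esub>"
    by (intro bexI)
qed (simp_all add: Homeo0_def comp_assoc)

lemma Aff_subset_Homeo0: "Aff \<subseteq> carrier Homeo0"
proof
  fix f assume "f \<in> Aff"
  then obtain a b where ab: "a > 0" "f = (\<lambda>x. a * x + b)"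
    by (auto simp: Aff_def)
  have "homeomorphism UNIV UNIV f (\<lambda>y. (y - b) / a)"
    using ab by (intro homeomorphismI) (auto intro!: continuous_intros)
  moreover have "strict_mono f"
    using ab by (simp add: strict_mono_def)
  ultimately show "f \<in> carrier Homeo0"
    unfolding Homeo0_def by simp blast
qed

lemma topspace_compact_open_Homeo0 [simp]: "topspace compact_open_Homeo0 = carrier Homeo0"
proof -
  have "{f \<in> carrier Homeo0. f ` {} \<subseteq> UNIV} \<in>
      {{f \<in> carrier Homeo0. f ` K \<subseteq> U} | K U. compact K \<and> open U}"
    by blast
  then have "carrier Homeo0 \<in>
      {{f \<in> carrier Homeo0. f ` K \<subseteq> U} | K U. compact K \<and> open U}"
    by simp
  then show ?thesis
    unfolding compact_open_Homeo0_def topology_generated_by_topspace by blast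
qed

lemma topspace_Hom_irr_topology [simp]: "topspace (Hom_irr_topology G) = Hom_irr G"
  by (auto simp: Hom_irr_topology_def Hom_irr_def hom_def PiE_def)

end

theory Submission
  imports Defs
begin

text \<open>
  Why the set is open. Let \<open>N\<close> be the nilpotent normal subgroup and let \<open>\<phi>\<close> be
  semi-conjugate to a non-abelian affine action \<open>\<psi>\<close>. Then \<open>\<psi>\<close> maps \<open>N\<close> to translations, not all
  trivial: neither a nilpotent nor a virtually nilpotent group of affine maps contains two
  contractions with different fixed points, because powers of such contractions play ping-pong. So some \<open>s \<in> N\<close> acts
  through \<open>\<psi>\<close> as a translation, and a suitable \<open>g0\<close> conjugates it to a translation more than
  twice as long. Read through \<open>\<phi>\<close>, this says that \<open>s\<close> moves every point to the right and that
  \<open>s\<^sup>2\<close> moves \<open>0\<close> less far than the conjugate of \<open>s\<close> by \<open>g0\<close> does (\<open>detect_expanded_translation\<close>).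
  In particular each of the finitely many elements \<open>g\<close>, \<open>g s g\<^sup>-\<^sup>1\<close>, \<open>g s\<^sup>-\<^sup>1 g\<^sup>-\<^sup>1\<close>, with \<open>g\<close> ranging
  over a symmetric generating set, moves \<open>0\<close> to a point between two points of its orbit under \<open>s\<close>.
  All these are finitely many strict inequalities between images of \<open>0\<close>, so they survive small
  perturbations of \<open>\<phi>\<close>.

  Conversely these inequalities already force an irreducible action to be semi-conjugate to a
  non-abelian affine one (\<open>expanded_translation_imp_affine\<close>). Nilpotency of \<open>N\<close> enters only by
  excluding ping-pong, in the shape of \<open>crossing_right\<close>: if \<open>s \<in> N\<close> pushes an interval towards
  its fixed endpoint \<open>d\<close>, then no element of \<open>N\<close> moves \<open>d\<close> into that interval. Hence if \<open>s\<close> had a fixed point,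
  the fixed point of \<open>s\<close> closest to \<open>0\<close> on its side would be fixed by every generator, against
  irreducibility; so \<open>s\<close> acts freely (\<open>free_if_irreducible\<close>). The relation "\<open>x\<close> is somewhere at most
  \<open>y\<close>" on \<open>N\<close> is then an Archimedean total preorder, invariant under multiplication and under
  conjugation by \<open>G\<close>; a theorem of Hoelder turns it into a homomorphism \<open>\<tau>\<close> from \<open>N\<close> to the
  reals, the translation number, which conjugation by \<open>g\<close> rescales by some \<open>multiplier g > 0\<close>.
  The inequality for \<open>g0\<close> gives \<open>multiplier g0 \<ge> 2\<close>; therefore \<open>\<tau>\<close> has dense image, and density
  makes the monotone map \<open>h x = sup {\<tau> n | n 0 \<le> x}\<close> equivariant with respect to affine maps with
  slopes \<open>multiplier g\<close> (\<open>height_act\<close>).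
\<close>

section \<open>The Thue-Morse law of nilpotent groups\<close>

text \<open>
  The two Thue-Morse words of level \<open>n\<close> in \<open>x\<close> and \<open>y\<close>, evaluated in \<open>G\<close>; exchanging \<open>x\<close> and \<open>y\<close>
  exchanges the two words. They begin with different letters, yet they agree in every group of
  nilpotency class \<open>n\<close>. This makes them a convenient obstruction to ping-pong.
\<close>

fun thue_morse :: "('a, 'b) monoid_scheme \<Rightarrow> 'a \<Rightarrow> 'a \<Rightarrow> nat \<Rightarrow> 'a" where
  "thue_morse G x y 0 = x"
| "thue_morse G x y (Suc n) = thue_morse G x y n \<otimes>\<^bsub>G\<^esub> thue_morse G y x n"

lemma (in group) thue_morse_closed:
  "x \<in> carrier G \<Longrightarrow> y \<in> carrier G \<Longrightarrow> thue_morse G x y n \<in> carrier G"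
  by (induction n arbitrary: x y) auto

lemma thue_morse_subgroup: "thue_morse (G\<lparr>carrier := H\<rparr>) x y n = thue_morse G x y n"
  by (induction n arbitrary: x y) auto

lemma hom_thue_morse:
  assumes "group G" "f \<in> hom G H" "x \<in> carrier G" "y \<in> carrier G"
  shows "f (thue_morse G x y n) = thue_morse H (f x) (f y) n"
  using assms(3,4)
  by (induction n arbitrary: x y)
    (auto simp: hom_mult[OF assms(2)] group.thue_morse_closed[OF assms(1)])

text \<open>
  If \<open>p = u q\<close>, then \<open>(p q) (q p)\<^sup>-\<^sup>1 = u q u\<^sup>-\<^sup>1 q\<^sup>-\<^sup>1\<close>: each level of the words puts their quotient into one
  more commutator.
\<close>

lemma (in group) thue_morse_quotient_mem_lower_central_series:
  assumes x: "x \<in> carrier G" and y: "y \<in> carrier G"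
  shows "thue_morse G x y n \<otimes> inv thue_morse G y x n \<in> lower_central_series G n"
proof (induction n)
  case 0
  show ?case using assms by simp
next
  case (Suc n)
  define p q where "p = thue_morse G x y n" and "q = thue_morse G y x n"
  have pq [simp]: "p \<in> carrier G" "q \<in> carrier G"
    using assms by (simp_all add: p_def q_def thue_morse_closed)
  define u where "u = p \<otimes> inv q"
  have u: "u \<in> lower_central_series G n" and [simp]: "u \<in> carrier G"
    using Suc by (simp_all add: u_def p_def[symmetric] q_def[symmetric])
  have "u \<otimes> q = p" and "inv u = q \<otimes> inv p"
    by (simp_all add: u_def m_assoc inv_mult_group)
  then have "u \<otimes> q \<otimes> inv u \<otimes> inv q = p \<otimes> (q \<otimes> inv p) \<otimes> inv q"
    by simp
  also have "\<dots> = (p \<otimes> q) \<otimes> inv (q \<otimes> p)"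
    by (simp add: inv_mult_group m_assoc)
  finally have eq: "thue_morse G x y (Suc n) \<otimes> inv thue_morse G y x (Suc n) = 
      u \<otimes> q \<otimes> inv u \<otimes> inv q"
    by (simp add: p_def q_def)
  show ?case
    unfolding eq lower_central_series.simps
    by (rule generate.incl) (use u pq in blast)
qed

lemma nilpotent_thue_morse_law:
  assumes "nilpotent_group G"
  obtains c where "\<And>x y. x \<in> carrier G \<Longrightarrow> y \<in> carrier G \<Longrightarrow> thue_morse G x y c = thue_morse G y x c"
proof -
  from assms obtain c where G: "group G" and c: "lower_central_series G c = {\<one>\<^bsub>G\<^esub>}"
    by (auto simp: nilpotent_group_def)
  interpret group G by (rule G)
  show thesis
  proof (rule that)
    fix x y assume xy: "x \<in> carrier G" "y \<in> carrier G"
    show "thue_morse G x y c = thue_morse G y x c"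
      using thue_morse_quotient_mem_lower_central_series[OF xy, of c] xy
      by (simp add: c thue_morse_closed inv_solve_right')
  qed
qed

text \<open>
  The maps are onto because the elements of \<open>G\<close> have inverses.
\<close>

locale line_action = group G for G (structure) +
  fixes \<phi> :: "'a \<Rightarrow> real \<Rightarrow> real"
  assumes act_mult: "x \<in> carrier G \<Longrightarrow> y \<in> carrier G \<Longrightarrow> \<phi> (x \<otimes> y) t = \<phi> x (\<phi> y t)"
    and act_strict_mono: "x \<in> carrier G \<Longrightarrow> strict_mono (\<phi> x)"
    and act_continuous: "x \<in> carrier G \<Longrightarrow> continuous_on UNIV (\<phi> x)"
begin

lemma act_less [simp]: "x \<in> carrier G \<Longrightarrow> \<phi> x t < \<phi> x u \<longleftrightarrow> t < u"
  using act_strict_mono strict_mono_less by blast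

lemma act_le [simp]: "x \<in> carrier G \<Longrightarrow> \<phi> x t \<le> \<phi> x u \<longleftrightarrow> t \<le> u"
  using act_strict_mono strict_mono_less_eq by blast

lemma act_eq [simp]: "x \<in> carrier G \<Longrightarrow> \<phi> x t = \<phi> x u \<longleftrightarrow> t = u"
  using act_strict_mono strict_mono_eq by blast

lemma act_one [simp]: "\<phi> \<one> t = t"
  by (metis act_eq act_mult one_closed l_one)

lemma act_inv_act [simp]: "x \<in> carrier G \<Longrightarrow> \<phi> (inv x) (\<phi> x t) = t"
  by (metis act_mult act_one inv_closed l_inv)

lemma act_act_inv [simp]: "x \<in> carrier G \<Longrightarrow> \<phi> x (\<phi> (inv x) t) = t"
  by (metis act_mult act_one inv_closed r_inv)

lemma act_inv_less: "x \<in> carrier G \<Longrightarrow> \<phi> (inv x) t < u \<longleftrightarrow> t < \<phi> x u"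
  by (metis act_act_inv act_less)

lemma less_act_inv: "x \<in> carrier G \<Longrightarrow> t < \<phi> (inv x) u \<longleftrightarrow> \<phi> x t < u"
  by (metis act_act_inv act_less)

lemma act_pow_fixed: "x \<in> carrier G \<Longrightarrow> \<phi> x t = t \<Longrightarrow> \<phi> (x [^] (n :: nat)) t = t"
  by (induction n) (simp_all add: act_mult)

lemma act_pow_Suc: "x \<in> carrier G \<Longrightarrow> \<phi> (x [^] Suc n) t = \<phi> x (\<phi> (x [^] n) t)"
  by (simp only: nat_pow_Suc2 act_mult nat_pow_closed)

text \<open>
  Ping-pong with two halves of \<open>I\<close>: a positive word in \<open>x\<close> and \<open>y\<close> maps \<open>I\<close> into the image of \<open>I\<close>
  under its first letter, and the two Thue-Morse words differ in their first letter.
\<close>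

lemma no_ping_pong:
  assumes x: "x \<in> carrier G" and y: "y \<in> carrier G"
    and law: "\<And>t. \<phi> (thue_morse G x y c) t = \<phi> (thue_morse G y x c) t"
    and I: "t0 \<in> I" "\<And>t. t \<in> I \<Longrightarrow> \<phi> x t \<in> I" "\<And>t. t \<in> I \<Longrightarrow> \<phi> y t \<in> I"
    and disj: "\<And>t u. t \<in> I \<Longrightarrow> u \<in> I \<Longrightarrow> \<phi> x t < \<phi> y u"
  shows False
proof -
  have image: "\<phi> (thue_morse G x y n) t \<in> \<phi> x ` I"
    if "x \<in> carrier G" "y \<in> carrier G" "\<forall>t\<in>I. \<phi> x t \<in> I" "\<forall>t\<in>I. \<phi> y t \<in> I" "t \<in> I"
    for n x y t
    using that
  proof (induction n arbitrary: x y t)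
    case (Suc n)
    note prems = Suc.prems
    have "\<phi> (thue_morse G y x n) t \<in> \<phi> y ` I"
      by (rule Suc.IH[OF prems(2,1,4,3,5)])
    with prems(4) have "\<phi> (thue_morse G y x n) t \<in> I"
      by fastforce
    from Suc.IH[OF prems(1-4) this] show ?case
      using prems(1,2) by (simp add: act_mult thue_morse_closed)
  qed simp
  from image[of x y t0 c] image[of y x t0 c]
  have "\<phi> (thue_morse G x y c) t0 \<in> \<phi> x ` I" "\<phi> (thue_morse G y x c) t0 \<in> \<phi> y ` I"
    using assms by auto
  then obtain t u where "t \<in> I" "u \<in> I" "\<phi> x t = \<phi> y u"
    by (auto simp: law)
  with disj show False by force
qed

lemma act_continuous_on: "x \<in> carrier G \<Longrightarrow> continuous_on A (\<phi> x)"
  using act_continuous continuous_on_subset by blast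

lemma fixed_point_between:
  assumes x: "x \<in> carrier G" and t: "t \<le> \<phi> x t" and u: "\<phi> x u \<le> u"
  obtains p where "min t u \<le> p" "p \<le> max t u" "\<phi> x p = p"
proof -
  have cont: "continuous_on A (\<lambda>v. \<phi> x v - v)" for A
    by (intro continuous_intros act_continuous_on x)
  show thesis
  proof (cases "t \<le> u")
    case True
    then obtain p where "t \<le> p" "p \<le> u" "\<phi> x p - p = 0"
      using IVT2'[of "\<lambda>v. \<phi> x v - v" u 0 t] t u cont by auto
    with True that show ?thesis by simp
  next
    case False
    then obtain p where "u \<le> p" "p \<le> t" "\<phi> x p - p = 0"
      using IVT'[of "\<lambda>v. \<phi> x v - v" u 0 t] t u cont by auto
    with False that show ?thesis by simp
  qed
qed

lemma orbit_passes:
  assumes x: "x \<in> carrier G" and up: "\<And>v. a \<le> v \<Longrightarrow> v \<le> b \<Longrightarrow> v < \<phi> x v"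
  obtains k :: nat where "b < \<phi> (x [^] k) a"
proof (rule ccontr)
  assume "\<not> thesis"
  with that have le: "\<phi> (x [^] k) a \<le> b" for k :: nat
    by (meson not_le)
  define f where "f = (\<lambda>k::nat. \<phi> (x [^] k) a)"
  have step: "f (Suc k) = \<phi> x (f k)" for k
    unfolding f_def by (rule act_pow_Suc[OF x])
  have ge: "a \<le> f k" for k
  proof (induction k)
    case (Suc k)
    have "f k < \<phi> x (f k)"
      using Suc le up by (simp add: f_def)
    then show ?case using Suc by (simp add: step)
  qed (simp add: f_def)
  have bd: "f k \<le> b" for k
    unfolding f_def by (rule le)
  have "incseq f"
    by (rule incseq_SucI) (simp add: step less_imp_le[OF up[OF ge bd]])
  then obtain L where L: "f \<longlonglongrightarrow> L"
    using incseq_convergent[of f b] bd by blast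
  have "a \<le> L" "L \<le> b"
    using L ge bd by (auto intro: LIMSEQ_le_const LIMSEQ_le_const2)
  have "(\<lambda>k. \<phi> x (f k)) \<longlonglongrightarrow> \<phi> x L"
    using act_continuous[OF x] L continuous_on_tendsto_compose by fastforce
  moreover have "(\<lambda>k. f (Suc k)) \<longlonglongrightarrow> L"
    using L LIMSEQ_Suc by blast
  ultimately have "\<phi> x L = L"
    by (simp add: step LIMSEQ_unique)
  with up \<open>a \<le> L\<close> \<open>L \<le> b\<close> show False by force
qed

lemma first_fixed_point:
  assumes x: "x \<in> carrier G" and a: "a < \<phi> x a" and u: "a \<le> u" "\<phi> x u = u"
  obtains d where "a < d" "d \<le> u" "\<phi> x d = d" "\<And>t. a \<le> t \<Longrightarrow> t < d \<Longrightarrow> t < \<phi> x t"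
proof -
  define F where "F = {t. a \<le> t \<and> \<phi> x t = t}"
  have F: "F = {a..} \<inter> {t. \<phi> x t = t}"
    by (auto simp: F_def)
  have "closed F"
    unfolding F by (intro closed_Int closed_atLeast closed_Collect_eq continuous_on_id act_continuous_on x)
  moreover have F': "F \<noteq> {}" "bdd_below F"
    using u by (auto simp: F_def)
  ultimately have d: "Inf F \<in> F"
    by (simp add: closed_contains_Inf)
  show thesis
  proof
    show fixed: "\<phi> x (Inf F) = Inf F" using d unfolding F_def by blast
    have "a \<le> Inf F" using d unfolding F_def by blast
    with fixed a show "a < Inf F" by (metis less_irrefl order_le_less)
    show "Inf F \<le> u" using u F'(2) by (intro cInf_lower) (simp_all add: F_def)
  next
    fix t assume t: "a \<le> t" "t < Inf F"
    show "t < \<phi> x t"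
    proof (rule ccontr)
      assume "\<not> t < \<phi> x t"
      with a x t obtain p where "a \<le> p" "p \<le> t" "\<phi> x p = p"
        using fixed_point_between[of x a t] by force
      then have "Inf F \<le> p"
        using F'(2) by (intro cInf_lower) (simp_all add: F_def)
      with t \<open>p \<le> t\<close> show False by simp
    qed
  qed
qed

text \<open>
  Conjugating by \<open>t \<mapsto> - t\<close> exchanges left and right, so each one-sided result below yields its
  mirror image.
\<close>

lemma reflected: "line_action G (\<lambda>x t. - \<phi> x (- t))"
proof unfold_locales
  fix x assume x: "x \<in> carrier G"
  show "strict_mono (\<lambda>t. - \<phi> x (- t))"
    using x by (intro strict_monoI) simp
  show "continuous_on UNIV (\<lambda>t. - \<phi> x (- t))"
    by (intro continuous_intros continuous_on_compose2[OF act_continuous[OF x]]) auto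
qed (simp add: act_mult)

end

section \<open>No crossings in a nilpotent normal subgroup\<close>

text \<open>
  Nilpotency of \<open>N\<close> enters the dynamics through the identity that its class \<open>c\<close> imposes on
  Thue-Morse words.
\<close>

locale thue_morse_action = line_action G \<phi> + normal N G
  for G (structure) and \<phi> and N +
  fixes c :: nat
  assumes law: "x \<in> N \<Longrightarrow> y \<in> N \<Longrightarrow> thue_morse G x y c = thue_morse G y x c"
begin

lemma pow_mem: "x \<in> N \<Longrightarrow> x [^] (k :: nat) \<in> N"
  by (induction k) auto

lemma conj_mem: "x \<in> N \<Longrightarrow> g \<in> carrier G \<Longrightarrow> g \<otimes> x \<otimes> inv g \<in> N"
  using inv_op_closed2 by blast

lemma reflected_thue_morse: "thue_morse_action G (\<lambda>x t. - \<phi> x (- t)) N c"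
  by (intro thue_morse_action.intro reflected normal_axioms thue_morse_action_axioms.intro law)

text \<open>
  Close to \<open>d\<close> the element \<open>s\<close> pushes to the right, towards \<open>d\<close>, while \<open>n\<close> moves \<open>d\<close> itself to the left, into
  the region where \<open>s\<close> pushes. After composing \<open>n\<close> with a power of \<open>s\<close>, it maps an interval \<open>[p, d]\<close>
  into \<open>[p, d)\<close>, and a high power of \<open>s\<close> maps \<open>[p, d]\<close> beyond that image: ping-pong.
\<close>

lemma crossing_right:
  assumes s: "s \<in> N" "\<phi> s d = d" and up: "\<And>t. a \<le> t \<Longrightarrow> t < d \<Longrightarrow> t < \<phi> s t"
    and n: "n \<in> N" "a < \<phi> n d" "\<phi> n d < d"
  shows False
proof -
  have carr [simp]: "s \<in> carrier G" "n \<in> carrier G" "\<And>k. s [^] (k :: nat) \<in> carrier G"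
    using s n by (auto simp: mem_carrier)
  have "\<phi> (inv n) a < d" "a < d"
    using n by (auto simp: act_inv_less)
  then obtain p where p: "a < p" "\<phi> (inv n) a < p" "p < d"
    using dense[of "max a (\<phi> (inv n) a)" d] by auto
  then have anp: "a < \<phi> n p"
    by (simp add: act_inv_less)
  obtain m :: nat where m: "p < \<phi> (s [^] m) (\<phi> n p)"
    by (rule orbit_passes[of s "\<phi> n p" p]) (use up p anp in auto)
  \<comment> \<open>The power of \<open>s\<close> repairs the left end: \<open>n\<close> may move \<open>p\<close> to the left of \<open>p\<close>.\<close>
  define y where "y = s [^] m \<otimes> n"
  have y: "y \<in> N" "y \<in> carrier G" "\<And>t. \<phi> y t = \<phi> (s [^] m) (\<phi> n t)"
    using s(1) n(1) by (auto simp: y_def act_mult pow_mem)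
  have "\<phi> y d < \<phi> (s [^] m) d"
    using n by (simp add: y)
  then have yd: "\<phi> y d < d"
    using s by (simp add: act_pow_fixed)
  have yp: "p < \<phi> y p"
    using m by (simp add: y)
  obtain k :: nat where k: "\<phi> y d < \<phi> (s [^] k) p"
    by (rule orbit_passes[of s p "\<phi> y d"]) (use up p yd in auto)
  show False
  proof (rule no_ping_pong[where x = y and y = "s [^] k" and c = c and I = "{p..d}" and ?t0.0 = d])
    show "\<phi> (thue_morse G y (s [^] k) c) t = \<phi> (thue_morse G (s [^] k) y c) t" for t
      using law y(1) s(1) pow_mem by simp
    show "\<phi> y t \<in> {p..d}" if "t \<in> {p..d}" for t
    proof -
      have "\<phi> y p \<le> \<phi> y t" "\<phi> y t \<le> \<phi> y d"
        using that y by simp_all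
      with yd yp show ?thesis by simp
    qed
    show "\<phi> (s [^] k) t \<in> {p..d}" if "t \<in> {p..d}" for t
    proof -
      have "\<phi> (s [^] k) p \<le> \<phi> (s [^] k) t" "\<phi> (s [^] k) t \<le> \<phi> (s [^] k) d"
        using that by simp_all
      moreover have "\<phi> y p \<le> \<phi> y d" "\<phi> (s [^] k) d = d"
        using p y s by (simp_all add: act_pow_fixed)
      ultimately show ?thesis
        unfolding atLeastAtMost_iff using k yp by linarith
    qed
    show "\<phi> y t < \<phi> (s [^] k) u" if "t \<in> {p..d}" "u \<in> {p..d}" for t u
    proof -
      have "\<phi> (s [^] k) p \<le> \<phi> (s [^] k) u" "\<phi> y t \<le> \<phi> y d"
        using that y by simp_all
      with k show ?thesis by linarith
    qed
  qed (use p y in auto)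
qed

lemma crossing_left:
  assumes s: "s \<in> N" "\<phi> s d = d" and down: "\<And>t. d < t \<Longrightarrow> t \<le> b \<Longrightarrow> \<phi> s t < t"
    and n: "n \<in> N" "d < \<phi> n d" "\<phi> n d < b"
  shows False
proof -
  interpret R: thue_morse_action G "\<lambda>x t. - \<phi> x (- t)" N c
    by (rule reflected_thue_morse)
  show False
  proof (rule R.crossing_right[of s "- d" "- b" n])
    show "t < - \<phi> s (- t)" if "- b \<le> t" "t < - d" for t
      using down[of "- t"] that by linarith
  qed (use s n in auto)
qed

text \<open>
  Take the first fixed point \<open>d\<close> of \<open>s\<close> to the right of \<open>a\<close>. By the absence of crossings the
  conjugate \<open>r\<close> of \<open>s\<close> by a generator \<open>g\<close> fixes \<open>d\<close> too: otherwise \<open>r\<close> or its inverse moves \<open>d\<close> to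
  the left, and the bounds on \<open>r\<close> at \<open>a\<close> keep the image in the region where \<open>s\<close> moves points up to
  \<open>d\<close>. So \<open>g\<^sup>-\<^sup>1 d\<close> is a fixed point of \<open>s\<close>; the bound on \<open>g\<close> puts it to the right of \<open>a\<close>, hence not
  to the left of \<open>d\<close>. As the generating set is symmetric, every generator fixes \<open>d\<close>.
\<close>

lemma global_fixed_point_right:
  assumes s: "s \<in> N" "a < \<phi> s a" and u: "a \<le> u" "\<phi> s u = u"
    and S: "S \<subseteq> carrier G" "generate G S = carrier G" "\<And>g. g \<in> S \<Longrightarrow> inv g \<in> S"
    and bounds: "\<And>g f. g \<in> S \<Longrightarrow> f \<in> {g, g \<otimes> s \<otimes> inv g} \<Longrightarrow>
      (\<exists>m::nat. \<phi> (inv s [^] m) a < \<phi> f a) \<and> (\<exists>m::nat. \<phi> f a < \<phi> (s [^] m) a)"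
  shows "\<exists>d. \<forall>g\<in>carrier G. \<phi> g d = d"
proof -
  have sc [simp]: "s \<in> carrier G" "inv s \<in> carrier G" "\<And>k. s [^] (k :: nat) \<in> carrier G"
    using s by (auto simp: mem_carrier)
  obtain d where d: "a < d" "\<phi> s d = d" and up: "\<And>t. a \<le> t \<Longrightarrow> t < d \<Longrightarrow> t < \<phi> s t"
    using first_fixed_point[of s a u] s u sc by metis
  have pow_less: "\<phi> (s [^] m) a < d" for m :: nat
  proof -
    have "\<phi> (s [^] m) a < \<phi> (s [^] m) d"
      using d by simp
    then show ?thesis
      using d by (simp add: act_pow_fixed)
  qed
  have up': "t < \<phi> s t" if "\<phi> (inv s [^] m) a \<le> t" "t < d" for m :: nat and t
  proof -
    have "\<phi> (s [^] m) (\<phi> (inv s [^] m) a) \<le> \<phi> (s [^] m) t"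
      using that by simp
    then have "a \<le> \<phi> (s [^] m) t"
      by (simp add: nat_pow_inv)
    moreover have "\<phi> (s [^] m) t < \<phi> (s [^] m) d"
      using that by simp
    ultimately have "\<phi> (s [^] m) t < \<phi> s (\<phi> (s [^] m) t)"
      using d by (intro up) (simp_all add: act_pow_fixed)
    also have "\<dots> = \<phi> (s [^] m) (\<phi> s t)"
      by (metis sc(1,3) act_mult act_pow_Suc nat_pow_Suc)
    finally show ?thesis by simp
  qed
  have le: "d \<le> \<phi> (inv g) d" if gS: "g \<in> S" for g
  proof -
    have g [simp]: "g \<in> carrier G" using gS S by blast
    define r where "r = g \<otimes> s \<otimes> inv g"
    have r: "r \<in> N" and [simp]: "r \<in> carrier G"
      using s g by (auto simp: r_def conj_mem)
    obtain m l :: nat where m: "\<phi> (inv s [^] m) a < \<phi> r a" "\<phi> r a < \<phi> (s [^] l) a"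
      using bounds[OF gS, of r] by (auto simp: r_def)
    have rad: "\<phi> r a < d" "\<phi> r a < \<phi> r d"
      using m(2) pow_less[of l] d by simp_all
    have "\<phi> r d = d"
    proof (rule linorder_cases)
      assume "\<phi> r d < d"
      then have False
        using crossing_right[of s d "\<phi> (inv s [^] m) a" r] s r d up' m rad by simp
      then show ?thesis ..
    next
      assume "d < \<phi> r d"
      then have False
        using crossing_right[of s d a "inv r"] s r d up rad by (simp add: act_inv_less less_act_inv)
      then show ?thesis ..
    qed
    moreover have "\<phi> r d = \<phi> g (\<phi> s (\<phi> (inv g) d))"
      by (simp add: r_def act_mult)
    ultimately have "\<phi> g (\<phi> s (\<phi> (inv g) d)) = \<phi> g (\<phi> (inv g) d)"
      by simp
    then have fixed: "\<phi> s (\<phi> (inv g) d) = \<phi> (inv g) d"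
      by (simp only: act_eq g)
    obtain m :: nat where "\<phi> g a < \<phi> (s [^] m) a"
      using bounds[OF gS, of g] by auto
    then have "a < \<phi> (inv g) d"
      using pow_less[of m] by (simp add: less_act_inv)
    with up[of "\<phi> (inv g) d"] fixed show ?thesis
      by linarith
  qed
  have fixed: "\<phi> g d = d" if "g \<in> S" for g
  proof -
    have g: "g \<in> carrier G" using that S by blast
    have "d \<le> \<phi> (inv g) d" "d \<le> \<phi> g d"
      using le[OF that] le[OF S(3)[OF that]] g by simp_all
    then have "\<phi> g d \<le> \<phi> g (\<phi> (inv g) d)" "d \<le> \<phi> g d"
      using g by (simp_all only: act_le)
    then show ?thesis
      using g by simp
  qed
  have "subgroup {g \<in> carrier G. \<phi> g d = d} G"
    by (rule subgroupI) (auto simp: act_mult, metis act_inv_act)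
  then have "generate G S \<subseteq> {g \<in> carrier G. \<phi> g d = d}"
    using S fixed by (intro generate_subgroup_incl) auto
  with S show ?thesis by auto
qed

lemma global_fixed_point_left:
  assumes s: "s \<in> N" "a < \<phi> s a" and u: "u \<le> a" "\<phi> s u = u"
    and S: "S \<subseteq> carrier G" "generate G S = carrier G" "\<And>g. g \<in> S \<Longrightarrow> inv g \<in> S"
    and bounds: "\<And>g f. g \<in> S \<Longrightarrow> f \<in> {g, g \<otimes> inv s \<otimes> inv g} \<Longrightarrow>
      (\<exists>m::nat. \<phi> (inv s [^] m) a < \<phi> f a) \<and> (\<exists>m::nat. \<phi> f a < \<phi> (s [^] m) a)"
  shows "\<exists>d. \<forall>g\<in>carrier G. \<phi> g d = d"
proof -
  interpret R: thue_morse_action G "\<lambda>x t. - \<phi> x (- t)" N c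
    by (rule reflected_thue_morse)
  have sc [simp]: "s \<in> carrier G"
    using s by (auto simp: mem_carrier)
  have "\<exists>d. \<forall>g\<in>carrier G. - \<phi> g (- d) = d"
  proof (rule R.global_fixed_point_right[of "inv s" "- a" "- u" S])
    have "\<phi> (inv s) a < a"
      using s by (simp add: act_inv_less)
    then show "- a < - \<phi> (inv s) (- (- a))" by simp
    have "\<phi> (inv s) u = u"
      using u by (metis act_inv_act sc)
    then show "- \<phi> (inv s) (- (- u)) = - u" by simp
  next
    fix g f assume "g \<in> S" "f \<in> {g, g \<otimes> inv s \<otimes> inv g}"
    then show "(\<exists>m::nat. - \<phi> (inv (inv s) [^] m) (- (- a)) < - \<phi> f (- (- a))) \<and>
        (\<exists>m::nat. - \<phi> f (- (- a)) < - \<phi> (inv s [^] m) (- (- a)))"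
      using bounds[of g f] by auto
  qed (use s u S in auto)
  then obtain d where "\<forall>g\<in>carrier G. - \<phi> g (- d) = d" ..
  then have "\<forall>g\<in>carrier G. \<phi> g (- d) = - d"
    by (metis minus_minus)
  then show ?thesis ..
qed

lemma free_if_irreducible:
  assumes irr: "\<not> (\<exists>d. \<forall>g\<in>carrier G. \<phi> g d = d)"
    and s: "s \<in> N" "a < \<phi> s a"
    and S: "S \<subseteq> carrier G" "generate G S = carrier G" "\<And>g. g \<in> S \<Longrightarrow> inv g \<in> S"
    and bounds: "\<And>g f. g \<in> S \<Longrightarrow> f \<in> {g, g \<otimes> s \<otimes> inv g, g \<otimes> inv s \<otimes> inv g} \<Longrightarrow>
      (\<exists>m::nat. \<phi> (inv s [^] m) a < \<phi> f a) \<and> (\<exists>m::nat. \<phi> f a < \<phi> (s [^] m) a)"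
  shows "t < \<phi> s t"
proof (rule ccontr)
  assume "\<not> t < \<phi> s t"
  then obtain u where "\<phi> s u = u"
    using fixed_point_between[of s a t] s by (metis less_imp_le mem_carrier not_less)
  then show False
    using global_fixed_point_right[OF s _ _ S, of u] global_fixed_point_left[OF s _ _ S, of u] bounds irr
    by (cases "a \<le> u") auto
qed

end

section \<open>The preorder of a nilpotent group acting on the line\<close>

context thue_morse_action
begin

text \<open>
  If \<open>n\<close> has some fixed points but none between \<open>x\<close> and \<open>u x\<close>, then \<open>x\<close> and \<open>u x\<close> lie in one
  component of the complement of the fixed points of \<open>n\<close>, and \<open>u\<close> or its inverse moves a finite endpoint of that
  component into its interior: a crossing.
\<close>

lemma fixed_points_syndetic:
  assumes u: "u \<in> N" "\<And>t. t < \<phi> u t" and n: "n \<in> N" "\<phi> n z = z"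
  obtains q where "x \<le> q" "q \<le> \<phi> u x" "\<phi> n q = q"
proof -
  have aux: "\<exists>q. x \<le> q \<and> q \<le> \<phi> u x \<and> \<phi> n q = q"
    if n: "n \<in> N" "\<phi> n z = z" and x: "x < \<phi> n x" for n
  proof (cases "\<exists>w\<ge>x. \<phi> n w = w")
    case True
    have [simp]: "n \<in> carrier G" "u \<in> carrier G"
      using n u by (auto simp: mem_carrier)
    obtain d where d: "x < d" "\<phi> n d = d" and up: "\<And>t. x \<le> t \<Longrightarrow> t < d \<Longrightarrow> t < \<phi> n t"
      using first_fixed_point[of n x] True x by (metis \<open>n \<in> carrier G\<close>)
    have "d \<le> \<phi> u x"
    proof (rule ccontr)
      assume "\<not> d \<le> \<phi> u x"
      then show False
        using crossing_right[of n d x "inv u"] n u d up by (simp add: act_inv_less less_act_inv)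
    qed
    with d show ?thesis by (intro exI[of _ d]) simp
  next
    case False
    interpret R: thue_morse_action G "\<lambda>x t. - \<phi> x (- t)" N c
      by (rule reflected_thue_morse)
    have [simp]: "n \<in> carrier G" "u \<in> carrier G"
      using n u by (auto simp: mem_carrier)
    have zx: "z < x"
      using False n by (metis not_le)
    have inv_z: "\<phi> (inv n) z = z"
      using n by (metis act_inv_act \<open>n \<in> carrier G\<close>)
    have "- x < - \<phi> (inv n) (- (- x))" "- x \<le> - z" "- \<phi> (inv n) (- (- z)) = - z" "inv n \<in> carrier G"
      using x zx inv_z by (simp_all add: act_inv_less)
    then obtain d where d: "- x < d" "- \<phi> (inv n) (- d) = d"
        and up: "\<And>t. - x \<le> t \<Longrightarrow> t < d \<Longrightarrow> t < - \<phi> (inv n) (- t)"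
      using R.first_fixed_point[of "inv n" "- x" "- z"] by metis
    have down: "\<phi> (inv n) t < t" if "- d < t" for t
    proof (cases "t \<le> x")
      case True
      then show ?thesis using up[of "- t"] that by simp
    next
      case beyond: False
      have "t < \<phi> n t"
      proof (rule ccontr)
        assume "\<not> t < \<phi> n t"
        then obtain p where "x \<le> p" "\<phi> n p = p"
          using fixed_point_between[of n x t] x beyond by force
        with False show False by blast
      qed
      then show ?thesis by (simp add: act_inv_less)
    qed
    have "\<phi> (inv n) (- d) = - d"
      using d by simp
    then have False
      using crossing_left[of "inv n" "- d" "\<phi> u (- d) + 1" u] down n u by simp
    then show ?thesis ..
  qed
  have [simp]: "n \<in> carrier G" using n by (auto simp: mem_carrier)
  show thesis
  proof (cases "\<phi> n x" x rule: linorder_cases)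
    case greater
    with aux[OF n] that show ?thesis by blast
  next
    case equal
    with that[of x] u show ?thesis by (simp add: less_imp_le)
  next
    case less
    then have "x < \<phi> (inv n) x" "\<phi> (inv n) z = z"
      using n by (simp_all add: less_act_inv) (metis act_inv_act \<open>n \<in> carrier G\<close>)
    with aux[of "inv n"] n obtain q where "x \<le> q" "q \<le> \<phi> u x" "\<phi> (inv n) q = q"
      by auto
    then show ?thesis
      using that[of q] by (metis act_act_inv \<open>n \<in> carrier G\<close>)
  qed
qed

text \<open>
  Comparing at some point rather than at every point makes the relation total; transitivity is
  what has to be earned.
\<close>

definition somewhere_le :: "'a \<Rightarrow> 'a \<Rightarrow> bool" where
  "somewhere_le x y \<longleftrightarrow> (\<exists>t. \<phi> x t \<le> \<phi> y t)"

text \<open>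
  Suppose that \<open>z\<close> is everywhere below \<open>x\<close>. Then \<open>u = z\<^sup>-\<^sup>1 x\<close> moves all points up, while the assumptions give fixed
  points to \<open>v = y\<^sup>-\<^sup>1 z\<close> and \<open>w = y\<^sup>-\<^sup>1 x = v u\<close>. If \<open>w\<close> fixes \<open>p\<close>, then \<open>v\<close> maps \<open>u p\<close> back to \<open>p\<close>, but
  \<open>v\<close> also fixes a point between \<open>p\<close> and \<open>u p\<close>, which is impossible for an increasing map.
\<close>

lemma somewhere_le_trans:
  assumes N: "x \<in> N" "y \<in> N" "z \<in> N" and xy: "somewhere_le x y" and yz: "somewhere_le y z"
  shows "somewhere_le x z"
proof (rule ccontr)
  assume "\<not> somewhere_le x z"
  then have zx: "\<phi> z t < \<phi> x t" for t
    by (auto simp: somewhere_le_def not_le)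
  have [simp]: "x \<in> carrier G" "y \<in> carrier G" "z \<in> carrier G"
    using N by (auto simp: mem_carrier)
  define u where "u = inv z \<otimes> x"
  define v where "v = inv y \<otimes> z"
  define w where "w = inv y \<otimes> x"
  have uvw: "u \<in> N" "v \<in> N" "w \<in> N"
    using N by (auto simp: u_def v_def w_def)
  then have [simp]: "u \<in> carrier G" "v \<in> carrier G" "w \<in> carrier G"
    by (auto simp: mem_carrier)
  have w: "\<phi> w t = \<phi> v (\<phi> u t)" for t
    by (simp add: u_def v_def w_def act_mult)
  have u: "t < \<phi> u t" for t
    using zx by (simp add: u_def act_mult less_act_inv)
  obtain t1 where t1: "\<phi> w t1 \<le> t1"
    using xy by (auto simp: somewhere_le_def w_def act_mult) (metis act_inv_act act_le inv_closed \<open>y \<in> carrier G\<close>)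
  obtain t2 where t2: "t2 \<le> \<phi> v t2"
    using yz by (auto simp: somewhere_le_def v_def act_mult) (metis act_inv_act act_le inv_closed \<open>y \<in> carrier G\<close>)
  have vw: "\<phi> v t < \<phi> w t" for t
    using u by (simp add: w)
  have "\<phi> v t1 \<le> t1" "t2 \<le> \<phi> w t2"
    using t1 t2 vw[of t1] vw[of t2] by simp_all
  obtain p where p: "\<phi> w p = p"
    using fixed_point_between[of w t2 t1] t1 \<open>t2 \<le> \<phi> w t2\<close> by auto
  obtain p' where "\<phi> v p' = p'"
    using fixed_point_between[of v t2 t1] t2 \<open>\<phi> v t1 \<le> t1\<close> by auto
  with u uvw obtain q where q: "p \<le> q" "q \<le> \<phi> u p" "\<phi> v q = q"
    using fixed_points_syndetic[of u v p' p] by auto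
  have "\<phi> v q \<le> \<phi> v (\<phi> u p)"
    using q(2) by simp
  also have "\<dots> = p"
    using p w by simp
  finally have "q = p"
    using q by simp
  with q p w have "\<phi> v (\<phi> u p) = \<phi> v p"
    by simp
  then show False
    using u[of p] by simp
qed

end


section \<open>Hoelder's theorem for preordered groups\<close>

text \<open>
  Hoelder's theorem: such a group carries an order-preserving homomorphism to the reals that maps
  \<open>s\<close> to \<open>1\<close>. It vanishes on everything equivalent to \<open>\<one>\<close>, so a preorder serves as well as an
  order.
\<close>

locale archimedean_preordered_group = group G for G (structure) +
  fixes le :: "'a \<Rightarrow> 'a \<Rightarrow> bool" (infix "\<preceq>" 50) and s :: 'a
  assumes total: "x \<in> carrier G \<Longrightarrow> y \<in> carrier G \<Longrightarrow> x \<preceq> y \<or> y \<preceq> x"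
    and trans: "x \<in> carrier G \<Longrightarrow> y \<in> carrier G \<Longrightarrow> z \<in> carrier G \<Longrightarrow> x \<preceq> y \<Longrightarrow> y \<preceq> z \<Longrightarrow> x \<preceq> z"
    and left: "x \<in> carrier G \<Longrightarrow> y \<in> carrier G \<Longrightarrow> z \<in> carrier G \<Longrightarrow> x \<preceq> y \<Longrightarrow> z \<otimes> x \<preceq> z \<otimes> y"
    and right: "x \<in> carrier G \<Longrightarrow> y \<in> carrier G \<Longrightarrow> z \<in> carrier G \<Longrightarrow> x \<preceq> y \<Longrightarrow> x \<otimes> z \<preceq> y \<otimes> z"
    and s [simp]: "s \<in> carrier G"
    and s_pos: "\<not> s \<preceq> \<one>"
    and archimedean: "x \<in> carrier G \<Longrightarrow> \<exists>k::nat. x \<preceq> s [^] k"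
begin

lemma refl: "x \<in> carrier G \<Longrightarrow> x \<preceq> x"
  using total by blast

lemma mult_mono:
  assumes "x \<in> carrier G" "y \<in> carrier G" "v \<in> carrier G" "w \<in> carrier G" "x \<preceq> y" "v \<preceq> w"
  shows "x \<otimes> v \<preceq> y \<otimes> w"
  using assms by (meson left right trans m_closed)

lemma pow_mono:
  assumes "x \<in> carrier G" "y \<in> carrier G" "x \<preceq> y"
  shows "x [^] (k :: nat) \<preceq> y [^] k"
  using assms by (induction k) (auto simp: refl mult_mono)

lemma one_le_pow: "\<one> \<preceq> s [^] (k :: nat)"
proof -
  have "\<one> \<preceq> s"
    using total[of s \<one>] s_pos by simp
  from pow_mono[OF _ _ this, of k] show ?thesis by simp
qed

lemma s_pow_le_iff: "s [^] (i :: int) \<preceq> s [^] (j :: int) \<longleftrightarrow> i \<le> j"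
proof -
  have le: "s [^] i \<preceq> s [^] (i + int k)" for i :: int and k :: nat
    using left[OF _ _ _ one_le_pow[of k], of "s [^] i"] by (simp add: int_pow_mult int_pow_int)
  show ?thesis
  proof
    assume "i \<le> j"
    then show "s [^] i \<preceq> s [^] j"
      using le[of i "nat (j - i)"] by simp
  next
    assume ij: "s [^] i \<preceq> s [^] j"
    show "i \<le> j"
    proof (rule ccontr)
      assume "\<not> i \<le> j"
      then have "s [^] (j + 1) \<preceq> s [^] i"
        using le[of "j + 1" "nat (i - (j + 1))"] by simp
      with ij have "s [^] (j + 1) \<preceq> s [^] j"
        by (meson trans int_pow_closed s)
      then have "s [^] (- j) \<otimes> s [^] (j + 1) \<preceq> s [^] (- j) \<otimes> s [^] j"
        by (intro left) auto
      then show False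
        using s_pos by (simp flip: int_pow_mult)
    qed
  qed
qed

text \<open>
  The integer part of \<open>x\<close> when \<open>s\<close> is the unit of length.
\<close>

lemma bracket:
  assumes x: "x \<in> carrier G"
  obtains p :: int where "s [^] p \<preceq> x" "x \<preceq> s [^] (p + 1)"
proof -
  obtain k :: nat where "inv x \<preceq> s [^] k"
    using archimedean x by blast
  then have "(x \<otimes> inv x) \<otimes> s [^] (- int k) \<preceq> (x \<otimes> s [^] k) \<otimes> s [^] (- int k)"
    using x by (intro right left) auto
  then have low: "s [^] (- int k) \<preceq> x"
    using x by (simp add: m_assoc int_pow_neg_int)
  obtain l :: nat where "x \<preceq> s [^] l"
    using archimedean x by blast
  then have ex: "x \<preceq> s [^] (- int k + int (k + l))"
    by (simp add: int_pow_int)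
  define j where "j = (LEAST j. x \<preceq> s [^] (- int k + int j))"
  have j: "x \<preceq> s [^] (- int k + int j)"
    unfolding j_def by (rule LeastI[of _ "k + l"]) (rule ex)
  show thesis
  proof (cases j)
    case 0
    have "x \<preceq> s [^] (- int k + 1)"
      using trans[OF x _ _ j, of "s [^] (- int k + 1)"] by (simp add: s_pow_le_iff 0)
    with low show thesis by (rule that)
  next
    case (Suc i)
    then have "\<not> x \<preceq> s [^] (- int k + int i)"
      unfolding j_def using not_less_Least[of i] by (metis lessI)
    then have "s [^] (- int k + int i) \<preceq> x"
      using total[OF x, of "s [^] (- int k + int i)"] by simp
    moreover have "x \<preceq> s [^] (- int k + int i + 1)"
      using j by (simp add: Suc algebra_simps)
    ultimately show thesis by (rule that)
  qed
qed

text \<open>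
  The rational lower bounds for the size of \<open>x\<close> in units of \<open>s\<close>.
\<close>

definition ratios :: "'a \<Rightarrow> real set" where
  "ratios x = {real_of_int p / real q | p q. 0 < q \<and> s [^] p \<preceq> x [^] q}"

definition size_of :: "'a \<Rightarrow> real" where
  "size_of x = Sup (ratios x)"

lemma ratios_le:
  assumes x: "x \<in> carrier G" and q: "0 < q" and xq: "x [^] q \<preceq> s [^] p" and r: "r \<in> ratios x"
  shows "r \<le> real_of_int p / real q"
proof -
  obtain p' q' where r': "r = real_of_int p' / real q'" "0 < q'" "s [^] p' \<preceq> x [^] q'"
    using r by (auto simp: ratios_def)
  have "(s [^] p') [^] q \<preceq> (x [^] q') [^] q" "(x [^] q) [^] q' \<preceq> (s [^] p) [^] q'"
    using r' xq x by (auto intro!: pow_mono)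
  moreover have "(s [^] i) [^] j = s [^] (i * int j)" for i :: int and j :: nat
    using int_pow_pow[OF s, of i "int j"] by (simp add: int_pow_int mult.commute)
  ultimately have "s [^] (p' * int q) \<preceq> x [^] (q * q')" "x [^] (q * q') \<preceq> s [^] (p * int q')"
    using x by (simp_all add: nat_pow_pow mult.commute)
  then have "s [^] (p' * int q) \<preceq> s [^] (p * int q')"
    by (rule trans[rotated 3]) (use x in auto)
  then have "p' * int q \<le> p * int q'"
    by (simp add: s_pow_le_iff)
  then have "real_of_int p' * real q \<le> real_of_int p * real q'"
    by (metis of_int_le_iff of_int_mult of_int_of_nat_eq)
  then show ?thesis
    unfolding r'(1) using q r'(2) by (simp add: field_simps)
qed

lemma ratios_nonempty_bdd:
  assumes x: "x \<in> carrier G"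
  shows "ratios x \<noteq> {}" "bdd_above (ratios x)"
proof -
  obtain p :: int where p: "s [^] p \<preceq> x" "x \<preceq> s [^] (p + 1)"
    by (rule bracket[OF x])
  show "ratios x \<noteq> {}"
    unfolding ratios_def using p x by (auto intro!: exI[of _ p] exI[of _ "1::nat"])
  show "bdd_above (ratios x)"
    using ratios_le[OF x, of 1] p x by (auto simp: bdd_above_def)
qed

lemma size_of_le:
  assumes x: "x \<in> carrier G" and q: "0 < q" and xq: "x [^] q \<preceq> s [^] p"
  shows "real q * size_of x \<le> real_of_int p"
proof -
  have "size_of x \<le> real_of_int p / real q"
    unfolding size_of_def by (rule cSup_least) (use ratios_nonempty_bdd[OF x] ratios_le[OF assms] in auto)
  then show ?thesis using q by (simp add: field_simps)
qed

lemma size_of_ge: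
  assumes x: "x \<in> carrier G" and q: "0 < q" and xq: "s [^] p \<preceq> x [^] q"
  shows "real_of_int p \<le> real q * size_of x"
proof -
  have "real_of_int p / real q \<le> size_of x"
    unfolding size_of_def
    by (rule cSup_upper) (use ratios_nonempty_bdd[OF x] q xq in \<open>auto simp: ratios_def\<close>)
  then show ?thesis using q by (simp add: field_simps)
qed

lemma size_of_mono:
  assumes x: "x \<in> carrier G" "y \<in> carrier G" "x \<preceq> y"
  shows "size_of x \<le> size_of y"
  unfolding size_of_def
proof (rule cSup_subset_mono)
  show "ratios x \<subseteq> ratios y"
  proof
    fix r assume "r \<in> ratios x"
    then obtain p q where r: "r = real_of_int p / real q" "0 < q" "s [^] p \<preceq> x [^] q"
      by (auto simp: ratios_def)
    have "s [^] p \<preceq> y [^] q"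
      by (rule trans[OF _ _ _ r(3) pow_mono[OF assms]]) (use x in auto)
    with r show "r \<in> ratios y"
      by (auto simp: ratios_def)
  qed
qed (use x ratios_nonempty_bdd in auto)

lemma size_of_s: "size_of s = 1"
  using size_of_le[of s 1 1] size_of_ge[of s 1 1] by (simp add: refl)

text \<open>
  Commutativity modulo the kernel is not known in advance. Instead, when \<open>x y\<close> lies below \<open>y x\<close>,
  sorting the letters of \<open>(x y)\<^sup>k\<close> one way only decreases the word and sorting them the other way
  only increases it.
\<close>

lemma pow_mult_bounds:
  assumes x: "x \<in> carrier G" and y: "y \<in> carrier G" and comm: "x \<otimes> y \<preceq> y \<otimes> x"
  shows "x [^] k \<otimes> y [^] k \<preceq> (x \<otimes> y) [^] (k :: nat)"
    and "(x \<otimes> y) [^] k \<preceq> y [^] k \<otimes> x [^] (k :: nat)"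
    and "x [^] k \<otimes> y [^] k \<preceq> (y \<otimes> x) [^] (k :: nat)"
    and "(y \<otimes> x) [^] k \<preceq> y [^] k \<otimes> x [^] (k :: nat)"
proof -
  note [simp] = x y
  have swap: "x [^] k \<otimes> y \<preceq> y \<otimes> x [^] k" for k :: nat
  proof (induction k)
    case (Suc k)
    have "x [^] k \<otimes> (x \<otimes> y) \<preceq> x [^] k \<otimes> (y \<otimes> x)"
      by (intro left comm) auto
    moreover have "(x [^] k \<otimes> y) \<otimes> x \<preceq> (y \<otimes> x [^] k) \<otimes> x"
      by (intro right Suc) auto
    ultimately show ?case
      using trans[of "x [^] k \<otimes> (x \<otimes> y)" "x [^] k \<otimes> (y \<otimes> x)" "(y \<otimes> x [^] k) \<otimes> x"]
      by (simp add: m_assoc)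
  qed (simp add: refl)
  have swap': "x \<otimes> y [^] k \<preceq> y [^] k \<otimes> x" for k :: nat
  proof (induction k)
    case (Suc k)
    have "(x \<otimes> y [^] k) \<otimes> y \<preceq> (y [^] k \<otimes> x) \<otimes> y"
      by (intro right Suc) auto
    moreover have "y [^] k \<otimes> (x \<otimes> y) \<preceq> y [^] k \<otimes> (y \<otimes> x)"
      by (intro left comm) auto
    ultimately show ?case
      using trans[of "(x \<otimes> y [^] k) \<otimes> y" "(y [^] k \<otimes> x) \<otimes> y" "y [^] k \<otimes> (y \<otimes> x)"]
      by (simp add: m_assoc)
  qed (simp add: refl)
  have lower: "x [^] k \<otimes> y [^] k \<preceq> (x \<otimes> y) [^] k" for k :: nat
  proof (induction k)
    case (Suc k)
    have "x [^] k \<otimes> (x \<otimes> y [^] k) \<otimes> y \<preceq> x [^] k \<otimes> (y [^] k \<otimes> x) \<otimes> y"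
      by (intro right left swap') auto
    moreover have "(x [^] k \<otimes> y [^] k) \<otimes> (x \<otimes> y) \<preceq> (x \<otimes> y) [^] k \<otimes> (x \<otimes> y)"
      by (intro right Suc) auto
    ultimately show ?case
      using trans[of "x [^] k \<otimes> (x \<otimes> y [^] k) \<otimes> y" "x [^] k \<otimes> (y [^] k \<otimes> x) \<otimes> y"
          "(x \<otimes> y) [^] k \<otimes> (x \<otimes> y)"]
      by (simp add: m_assoc)
  qed (simp add: refl)
  have upper: "(y \<otimes> x) [^] k \<preceq> y [^] k \<otimes> x [^] k" for k :: nat
  proof (induction k)
    case (Suc k)
    have "(y \<otimes> x) [^] k \<otimes> (y \<otimes> x) \<preceq> (y [^] k \<otimes> x [^] k) \<otimes> (y \<otimes> x)"
      by (intro right Suc) auto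
    moreover have "y [^] k \<otimes> (x [^] k \<otimes> y) \<otimes> x \<preceq> y [^] k \<otimes> (y \<otimes> x [^] k) \<otimes> x"
      by (intro right left swap) auto
    ultimately show ?case
      using trans[of "(y \<otimes> x) [^] k \<otimes> (y \<otimes> x)" "y [^] k \<otimes> (x [^] k \<otimes> y) \<otimes> x"
          "y [^] k \<otimes> (y \<otimes> x [^] k) \<otimes> x"]
      by (simp add: m_assoc)
  qed (simp add: refl)
  have mid: "(x \<otimes> y) [^] k \<preceq> (y \<otimes> x) [^] k" for k :: nat
    by (intro pow_mono comm) auto
  show "x [^] k \<otimes> y [^] k \<preceq> (x \<otimes> y) [^] k" "(y \<otimes> x) [^] k \<preceq> y [^] k \<otimes> x [^] k"
    by (rule lower upper)+
  show "(x \<otimes> y) [^] k \<preceq> y [^] k \<otimes> x [^] k"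
    by (rule trans[OF _ _ _ mid upper]) auto
  show "x [^] k \<otimes> y [^] k \<preceq> (y \<otimes> x) [^] k"
    by (rule trans[OF _ _ _ lower mid]) auto
qed

text \<open>
  If \<open>p\<close> and \<open>r\<close> are the integer parts of \<open>x\<^sup>k\<close> and \<open>y\<^sup>k\<close>, then \<open>x\<^sup>k y\<^sup>k\<close> and \<open>y\<^sup>k x\<^sup>k\<close> lie between
  \<open>s\<^sup>p s\<^sup>r\<close> and \<open>s\<^sup>p s\<^sup>r s\<^sup>2\<close>, and so does \<open>(x y)\<^sup>k\<close>, which lies between them. This
  determines the size of \<open>x y\<close> up to an error of \<open>2 / k\<close>.
\<close>

lemma size_of_mult:
  assumes x: "x \<in> carrier G" and y: "y \<in> carrier G"
  shows "size_of (x \<otimes> y) = size_of x + size_of y"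
proof -
  note [simp] = x y
  define D where "D = \<bar>size_of (x \<otimes> y) - size_of x - size_of y\<bar>"
  have bound: "real k * D \<le> 2" if k: "0 < k" for k :: nat
  proof -
    obtain p :: int where p: "s [^] p \<preceq> x [^] k" "x [^] k \<preceq> s [^] (p + 1)"
      by (rule bracket[OF nat_pow_closed[OF x, of k]]) blast
    obtain r :: int where r: "s [^] r \<preceq> y [^] k" "y [^] k \<preceq> s [^] (r + 1)"
      by (rule bracket[OF nat_pow_closed[OF y, of k]]) blast
    have low: "s [^] (p + r) \<preceq> x [^] k \<otimes> y [^] k" "s [^] (p + r) \<preceq> y [^] k \<otimes> x [^] k"
      using mult_mono[OF _ _ _ _ p(1) r(1)] mult_mono[OF _ _ _ _ r(1) p(1)]
      by (simp_all add: add.commute flip: int_pow_mult)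
    have high: "x [^] k \<otimes> y [^] k \<preceq> s [^] (p + r + 2)" "y [^] k \<otimes> x [^] k \<preceq> s [^] (p + r + 2)"
      using mult_mono[OF _ _ _ _ p(2) r(2)] mult_mono[OF _ _ _ _ r(2) p(2)]
      by (simp_all add: algebra_simps flip: int_pow_mult)
    have "s [^] (p + r) \<preceq> (x \<otimes> y) [^] k \<and> (x \<otimes> y) [^] k \<preceq> s [^] (p + r + 2)"
    proof (cases "x \<otimes> y \<preceq> y \<otimes> x")
      case True
      show ?thesis
        by (intro conjI trans[OF _ _ _ low(1) pow_mult_bounds(1)[OF x y True]]
            trans[OF _ _ _ pow_mult_bounds(2)[OF x y True] high(2)]) simp_all
    next
      case False
      then have yx: "y \<otimes> x \<preceq> x \<otimes> y" using total[of "x \<otimes> y" "y \<otimes> x"] by simp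
      show ?thesis
        by (intro conjI trans[OF _ _ _ low(2) pow_mult_bounds(3)[OF y x yx]]
            trans[OF _ _ _ pow_mult_bounds(4)[OF y x yx] high(1)]) simp_all
    qed
    then have "real_of_int (p + r) \<le> real k * size_of (x \<otimes> y)"
        "real k * size_of (x \<otimes> y) \<le> real_of_int (p + r + 2)"
      using size_of_ge[OF _ k, of "x \<otimes> y" "p + r"] size_of_le[OF _ k, of "x \<otimes> y" "p + r + 2"] by simp_all
    moreover have "real_of_int p \<le> real k * size_of x" "real k * size_of x \<le> real_of_int (p + 1)"
        "real_of_int r \<le> real k * size_of y" "real k * size_of y \<le> real_of_int (r + 1)"
      using size_of_ge[OF x k p(1)] size_of_le[OF x k p(2)] size_of_ge[OF y k r(1)] size_of_le[OF y k r(2)]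
      by simp_all
    ultimately have "\<bar>real k * size_of (x \<otimes> y) - real k * size_of x - real k * size_of y\<bar> \<le> 2"
      by simp
    moreover have "real k * size_of (x \<otimes> y) - real k * size_of x - real k * size_of y =
        real k * (size_of (x \<otimes> y) - size_of x - size_of y)"
      by (simp add: algebra_simps)
    ultimately show ?thesis
      by (simp add: D_def abs_mult)
  qed
  have "D = 0"
  proof (rule ccontr)
    assume "D \<noteq> 0"
    then have "0 < D" by (simp add: D_def)
    then obtain k :: nat where "2 < real k * D"
      using reals_Archimedean3 by blast
    then show False
      using bound[of k] by (cases "k = 0") auto
  qed
  then show ?thesis by (simp add: D_def)
qed

end

lemma additive_int_pow:
  fixes G (structure) and f :: "'a \<Rightarrow> real"
  assumes "subgroup N G" "group G" and add: "\<forall>x\<in>N. \<forall>y\<in>N. f (x \<otimes> y) = f x + f y"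
    and x: "x \<in> N"
  shows "f (x [^] (p :: int)) = of_int p * f x" "f (x [^] (k :: nat)) = of_nat k * f x"
    "f (inv x) = - f x" "f \<one> = 0"
proof -
  interpret group G by fact
  interpret N: subgroup N G by fact
  have xc [simp]: "x \<in> carrier G" using x by (rule N.mem_carrier)
  have one: "f \<one> = 0"
    using add[rule_format, of \<one> \<one>] by simp
  have inv: "f (inv y) = - f y" if "y \<in> N" for y
  proof -
    have "f (y \<otimes> inv y) = f y + f (inv y)"
      by (rule add[rule_format, OF that N.m_inv_closed[OF that]])
    then show ?thesis
      unfolding r_inv[OF N.mem_carrier[OF that]] one by linarith
  qed
  have nat_mem: "x [^] k \<in> N" for k :: nat
    by (induction k) (use x in auto)
  have nat: "f (x [^] k) = of_nat k * f x" for k :: nat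
    by (induction k) (simp_all add: one add[rule_format, OF nat_mem x] algebra_simps)
  show "f (x [^] p) = of_int p * f x"
  proof (cases "p < 0")
    case True
    then have "x [^] p = inv (x [^] nat (- p))"
      by (simp only: int_pow_def2 if_True)
    then show ?thesis
      by (simp only: inv[OF nat_mem] nat) (use True in simp)
  next
    case False
    then have "x [^] p = x [^] nat p"
      by (simp only: int_pow_def2 if_False)
    then show ?thesis
      by (simp only: nat) (use False in simp)
  qed
  show "f (x [^] k) = of_nat k * f x" "f (inv x) = - f x" "f \<one> = 0"
    using x by (simp_all add: nat inv one)
qed

text \<open>
  Squeeze \<open>n\<^sup>q\<close> between consecutive powers of \<open>s\<close> with respect to \<open>f\<close>; then \<open>k\<close> squeezes it in the
  same way, and dividing by \<open>q\<close> gives the claim.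
\<close>

lemma additive_proportional:
  fixes G (structure) and f k :: "'a \<Rightarrow> real"
  assumes N: "subgroup N G" "group G"
    and f: "\<forall>x\<in>N. \<forall>y\<in>N. f (x \<otimes> y) = f x + f y"
    and k: "\<forall>x\<in>N. \<forall>y\<in>N. k (x \<otimes> y) = k x + k y"
    and mono: "\<And>x y. x \<in> N \<Longrightarrow> y \<in> N \<Longrightarrow> f x < f y \<Longrightarrow> k x \<le> k y"
    and s: "s \<in> N" "f s = 1" and n: "n \<in> N"
  shows "k n = k s * f n"
proof -
  interpret group G by fact
  interpret N: subgroup N G by fact
  note f_pow = additive_int_pow[OF N f]
  note k_pow = additive_int_pow[OF N k]
  have pow_mem: "x [^] p \<in> N" if "x \<in> N" for x and p :: int
    using subgroup_int_pow_closed[OF N(1) that] .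
  have ks: "0 \<le> k s"
    using mono[of \<one> s] s f_pow(4)[OF s(1)] k_pow(4)[OF s(1)] by simp
  define D where "D = \<bar>k n - k s * f n\<bar>"
  have bound: "real q * D \<le> 2 * k s" for q :: nat
  proof -
    define p where "p = \<lfloor>real q * f n\<rfloor>"
    have p: "real_of_int p \<le> real q * f n" "real q * f n < real_of_int p + 1"
      by (simp_all add: p_def)
    \<comment> \<open>The exponent \<open>p - 1\<close> instead of \<open>p\<close> makes the comparison under \<open>f\<close> strict.\<close>
    have "k (s [^] (p - 1)) \<le> k (n [^] int q)" "k (n [^] int q) \<le> k (s [^] (p + 1))"
      by (intro mono pow_mem s n; use p s n in \<open>simp add: f_pow\<close>)+
    then have low: "(real_of_int p - 1) * k s \<le> real q * k n"
      and high: "real q * k n \<le> (real_of_int p + 1) * k s"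
      using s n by (simp_all add: k_pow)
    have "k s * real_of_int p \<le> k s * (real q * f n)" "k s * (real q * f n) \<le> k s * (real_of_int p + 1)"
      using p ks by (auto intro!: mult_left_mono)
    with low high have "\<bar>real q * k n - k s * (real q * f n)\<bar> \<le> 2 * k s"
      using ks by (simp add: algebra_simps abs_le_iff)
    moreover have "real q * k n - k s * (real q * f n) = real q * (k n - k s * f n)"
      by (simp add: algebra_simps)
    ultimately show ?thesis
      by (simp add: D_def abs_mult)
  qed
  have "D = 0"
  proof (rule ccontr)
    assume "D \<noteq> 0"
    then have "0 < D" by (simp add: D_def)
    then obtain q :: nat where "2 * k s < real q * D"
      using reals_Archimedean3 by blast
    with bound[of q] show False by simp
  qed
  then show ?thesis by (simp add: D_def)
qed

section \<open>Translation numbers and the equivariant height\<close>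

text \<open>
  The map \<open>\<tau>\<close> measures how far elements of \<open>N\<close> translate the line, in units of \<open>s\<close>.
\<close>

locale translation_number = thue_morse_action +
  fixes \<tau> :: "'a \<Rightarrow> real" and s :: 'a
  assumes tau_mult: "\<And>x y. x \<in> N \<Longrightarrow> y \<in> N \<Longrightarrow> \<tau> (x \<otimes> y) = \<tau> x + \<tau> y"
    and tau_mono: "\<And>x y. x \<in> N \<Longrightarrow> y \<in> N \<Longrightarrow> somewhere_le x y \<Longrightarrow> \<tau> x \<le> \<tau> y"
    and s_mem: "s \<in> N" and tau_s: "\<tau> s = 1" and s_free: "\<And>t. t < \<phi> s t"

lemma (in thue_morse_action) translation_number_exists:
  assumes s: "s \<in> N" "\<And>t. t < \<phi> s t"
  shows "\<exists>\<tau>. translation_number G \<phi> N c \<tau> s"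
proof -
  interpret P: archimedean_preordered_group "G\<lparr>carrier := N\<rparr>" somewhere_le s
  proof (rule archimedean_preordered_group.intro, rule subgroup.subgroup_is_group[OF subgroup_axioms is_group],
      unfold_locales)
    fix x y z assume x: "x \<in> carrier (G\<lparr>carrier := N\<rparr>)" and y: "y \<in> carrier (G\<lparr>carrier := N\<rparr>)"
    show "somewhere_le x y \<or> somewhere_le y x"
      by (auto simp: somewhere_le_def) (metis linear)
    assume z: "z \<in> carrier (G\<lparr>carrier := N\<rparr>)"
    show "somewhere_le x z" if "somewhere_le x y" "somewhere_le y z"
      using somewhere_le_trans[OF _ _ _ that] x y z by simp
    have c: "x \<in> carrier G" "y \<in> carrier G" "z \<in> carrier G"
      using x y z by (simp_all add: mem_carrier)
    assume "somewhere_le x y"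
    then obtain t where t: "\<phi> x t \<le> \<phi> y t"
      by (auto simp: somewhere_le_def)
    show "somewhere_le (z \<otimes>\<^bsub>G\<lparr>carrier := N\<rparr>\<^esub> x) (z \<otimes>\<^bsub>G\<lparr>carrier := N\<rparr>\<^esub> y)"
      using t c by (auto simp: somewhere_le_def act_mult)
    have "\<phi> (x \<otimes> z) (\<phi> (inv z) t) \<le> \<phi> (y \<otimes> z) (\<phi> (inv z) t)"
      using t c by (simp add: act_mult)
    then show "somewhere_le (x \<otimes>\<^bsub>G\<lparr>carrier := N\<rparr>\<^esub> z) (y \<otimes>\<^bsub>G\<lparr>carrier := N\<rparr>\<^esub> z)"
      by (auto simp: somewhere_le_def)
  next
    fix x assume x: "x \<in> carrier (G\<lparr>carrier := N\<rparr>)"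
    obtain k :: nat where "\<phi> x 0 < \<phi> (s [^] k) 0"
      by (rule orbit_passes[of s 0 "\<phi> x 0"]) (use s in \<open>auto simp: mem_carrier\<close>)
    then have "somewhere_le x (s [^] k)"
      unfolding somewhere_le_def by (intro exI[of _ 0]) simp
    then show "\<exists>k::nat. somewhere_le x (s [^]\<^bsub>G\<lparr>carrier := N\<rparr>\<^esub> k)"
      using nat_pow_consistent by metis
  next
    show "\<not> somewhere_le s \<one>\<^bsub>G\<lparr>carrier := N\<rparr>\<^esub>"
      using s(2) by (auto simp: somewhere_le_def not_le)
  qed (use s in simp)
  have "translation_number G \<phi> N c P.size_of s"
    by unfold_locales (use s P.size_of_mult P.size_of_s P.size_of_mono in auto)
  then show ?thesis by (intro exI[of _ P.size_of])
qed

context translation_number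
begin

lemma s_carrier [simp]: "s \<in> carrier G"
  using s_mem by (rule mem_carrier)

lemma tau_pow:
  assumes "x \<in> N"
  shows "\<tau> (x [^] (p :: int)) = of_int p * \<tau> x" "\<tau> (x [^] (k :: nat)) = of_nat k * \<tau> x"
    "\<tau> (inv x) = - \<tau> x"
  using additive_int_pow[OF subgroup_axioms is_group _ assms, of \<tau>] tau_mult by simp_all

lemma tau_one: "\<tau> \<one> = 0"
  using additive_int_pow(4)[OF subgroup_axioms is_group _ s_mem, of \<tau>] tau_mult by simp

lemma tau_less: "x \<in> N \<Longrightarrow> y \<in> N \<Longrightarrow> \<tau> x < \<tau> y \<Longrightarrow> \<phi> x t < \<phi> y t"
  using tau_mono[of y x] unfolding somewhere_le_def by (meson leD leI)

lemma tau_pos: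
  assumes x: "x \<in> N" "\<And>t. t < \<phi> x t"
  shows "0 < \<tau> x"
proof -
  obtain k :: nat where k: "\<phi> s 0 < \<phi> (x [^] k) 0"
    by (rule orbit_passes[of x 0 "\<phi> s 0"]) (use x in \<open>auto simp: mem_carrier\<close>)
  then have "\<tau> s \<le> \<tau> (x [^] k)"
    by (intro tau_mono s_mem pow_mem x) (auto simp: somewhere_le_def intro: less_imp_le)
  then have "1 \<le> real k * \<tau> x"
    using x by (simp add: tau_s tau_pow)
  then show ?thesis
    by (metis less_numeral_extra(1) mult_nonneg_nonpos not_le of_nat_0_le_iff order_less_le_trans)
qed

definition multiplier :: "'a \<Rightarrow> real" where
  "multiplier g = \<tau> (g \<otimes> s \<otimes> inv g)"

text \<open>
  Conjugation by \<open>g\<close> preserves the comparison of elements of \<open>N\<close> on the line, so \<open>\<tau>\<close> composed with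
  conjugation is proportional to \<open>\<tau>\<close>.
\<close>

lemma tau_conj:
  assumes g: "g \<in> carrier G" and n: "n \<in> N"
  shows "\<tau> (g \<otimes> n \<otimes> inv g) = multiplier g * \<tau> n"
  unfolding multiplier_def
proof (rule additive_proportional[OF subgroup_axioms is_group, where f = \<tau> and k = "\<lambda>n. \<tau> (g \<otimes> n \<otimes> inv g)"])
  show "\<forall>x\<in>N. \<forall>y\<in>N. \<tau> (g \<otimes> (x \<otimes> y) \<otimes> inv g) = \<tau> (g \<otimes> x \<otimes> inv g) + \<tau> (g \<otimes> y \<otimes> inv g)"
  proof (intro ballI)
    fix x y assume xy: "x \<in> N" "y \<in> N"
    then have c: "x \<in> carrier G" "y \<in> carrier G" by (auto simp: mem_carrier)
    have "inv g \<otimes> (g \<otimes> (y \<otimes> inv g)) = y \<otimes> inv g"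
      using g c by (simp flip: m_assoc)
    then have "g \<otimes> (x \<otimes> y) \<otimes> inv g = (g \<otimes> x \<otimes> inv g) \<otimes> (g \<otimes> y \<otimes> inv g)"
      using g c by (simp add: m_assoc)
    then show "\<tau> (g \<otimes> (x \<otimes> y) \<otimes> inv g) = \<tau> (g \<otimes> x \<otimes> inv g) + \<tau> (g \<otimes> y \<otimes> inv g)"
      using tau_mult conj_mem g xy by simp
  qed
next
  fix x y assume xy: "x \<in> N" "y \<in> N" "\<tau> x < \<tau> y"
  then have c: "x \<in> carrier G" "y \<in> carrier G" by (auto simp: mem_carrier)
  have "\<phi> (g \<otimes> x \<otimes> inv g) 0 < \<phi> (g \<otimes> y \<otimes> inv g) 0"
    using tau_less[OF xy] g c by (simp add: act_mult)
  then show "\<tau> (g \<otimes> x \<otimes> inv g) \<le> \<tau> (g \<otimes> y \<otimes> inv g)"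
    using g xy by (intro tau_mono conj_mem) (auto simp: somewhere_le_def intro: less_imp_le)
qed (use n s_mem tau_s tau_mult in auto)

lemma multiplier_pos:
  assumes g: "g \<in> carrier G"
  shows "0 < multiplier g"
  unfolding multiplier_def
proof (rule tau_pos[OF conj_mem[OF s_mem g]])
  fix t
  have "t = \<phi> g (\<phi> (inv g) t)"
    using g by simp
  also have "\<dots> < \<phi> g (\<phi> s (\<phi> (inv g) t))"
    unfolding act_less[OF g] by (rule s_free)
  finally show "t < \<phi> (g \<otimes> s \<otimes> inv g) t"
    using g by (simp add: act_mult)
qed

lemma multiplier_mult:
  assumes g: "g \<in> carrier G" and k: "k \<in> carrier G"
  shows "multiplier (g \<otimes> k) = multiplier g * multiplier k"
proof -
  have "g \<otimes> k \<otimes> s \<otimes> inv (g \<otimes> k) = g \<otimes> (k \<otimes> s \<otimes> inv k) \<otimes> inv g"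
    using g k by (simp add: inv_mult_group m_assoc)
  then show ?thesis
    using tau_conj[OF g conj_mem[OF s_mem k]] by (simp add: multiplier_def)
qed

lemma multiplier_s: "multiplier s = 1"
  by (simp add: multiplier_def tau_s m_assoc)

lemma multiplier_one: "multiplier \<one> = 1"
  by (simp add: multiplier_def tau_s)

lemma multiplier_pow: "g \<in> carrier G \<Longrightarrow> multiplier (g [^] (k :: nat)) = multiplier g ^ k"
  by (induction k) (simp_all add: multiplier_one multiplier_mult)

text \<open>
  Conjugating \<open>s\<close> by high powers of \<open>g\<^sup>-\<^sup>1\<close> produces elements of arbitrarily small positive
  translation number; their multiples are dense.
\<close>

lemma tau_dense:
  assumes g: "g \<in> carrier G" "1 < multiplier g" and r: "r < r'"
  obtains n where "n \<in> N" "r < \<tau> n" "\<tau> n < r'"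
proof -
  have "multiplier (inv g) * multiplier g = 1"
    using multiplier_mult[of "inv g" g] g by (simp add: multiplier_one)
  then have "multiplier (inv g) < 1"
    using g multiplier_pos[of "inv g"]
    by (metis inv_closed less_le_not_le mult.right_neutral mult_strict_left_mono not_le order_less_trans)
  then obtain k where k: "multiplier (inv g) ^ k < r' - r"
    using real_arch_pow_inv[of "r' - r" "multiplier (inv g)"] r by auto
  define d where "d = multiplier (inv g) ^ k"
  have d: "0 < d" "d < r' - r"
    using k multiplier_pos[of "inv g"] g by (simp_all add: d_def)
  define e where "e = inv g [^] k \<otimes> s \<otimes> inv (inv g [^] k)"
  have e: "e \<in> N" "\<tau> e = d"
    using conj_mem[OF s_mem, of "inv g [^] k"] multiplier_pow[of "inv g" k] g
    by (simp_all add: e_def d_def multiplier_def)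
  define p where "p = \<lfloor>r / d\<rfloor> + 1"
  have "r / d < real_of_int p" "real_of_int p \<le> r / d + 1"
    unfolding p_def by linarith+
  then have "r < real_of_int p * d" "real_of_int p * d \<le> r + d"
    using d by (simp_all add: field_simps)
  then show thesis
    using that[of "e [^] p"] e d subgroup_int_pow_closed[OF subgroup_axioms e(1)]
    by (simp add: tau_pow)
qed

text \<open>
  The height of \<open>x\<close> is the translation number at which the orbit of \<open>0\<close> under \<open>N\<close> passes \<open>x\<close>.
  It increases weakly in \<open>x\<close> and may jump or be locally constant; it is the semi-conjugacy.
\<close>

definition height :: "real \<Rightarrow> real" where
  "height x = Sup (\<tau> ` {n \<in> N. \<phi> n 0 \<le> x})"

lemma heights:
  shows heights_nonempty: "{n \<in> N. \<phi> n 0 \<le> x} \<noteq> {}"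
    and heights_bdd: "bdd_above (\<tau> ` {n \<in> N. \<phi> n 0 \<le> x})"
proof -
  obtain k :: nat where "0 < \<phi> (s [^] k) x"
    by (rule orbit_passes[of s x 0]) (use s_free in auto)
  then have "\<phi> (inv (s [^] k)) 0 < x"
    by (simp add: act_inv_less)
  moreover have "inv (s [^] k) \<in> N"
    using pow_mem s_mem by simp
  ultimately show "{n \<in> N. \<phi> n 0 \<le> x} \<noteq> {}"
    using less_imp_le by blast
  obtain l :: nat where l: "x < \<phi> (s [^] l) 0"
    by (rule orbit_passes[of s 0 x]) (use s_free in auto)
  have "\<tau> n \<le> \<tau> (s [^] l)" if "n \<in> N" "\<phi> n 0 \<le> x" for n
    using that l by (intro tau_mono pow_mem s_mem) (auto simp: somewhere_le_def intro!: exI[of _ 0])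
  then show "bdd_above (\<tau> ` {n \<in> N. \<phi> n 0 \<le> x})"
    by (auto simp: bdd_above_def)
qed

lemma height_ge: "n \<in> N \<Longrightarrow> \<phi> n 0 \<le> x \<Longrightarrow> \<tau> n \<le> height x"
  unfolding height_def using heights_bdd by (intro cSup_upper) auto

lemma height_le:
  assumes "\<And>n. n \<in> N \<Longrightarrow> \<phi> n 0 \<le> x \<Longrightarrow> \<tau> n \<le> r"
  shows "height x \<le> r"
  unfolding height_def using heights_nonempty[of x] assms by (intro cSup_least) auto

lemma act_le_if_tau_less_height:
  assumes n: "n \<in> N" "\<tau> n < height x"
  shows "\<phi> n 0 \<le> x"
proof -
  obtain n' where n': "n' \<in> N" "\<phi> n' 0 \<le> x" "\<tau> n < \<tau> n'"
    using n heights_nonempty heights_bdd unfolding height_def by (auto simp: less_cSup_iff)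
  then show ?thesis
    using tau_less[of n n' 0] n by simp
qed

lemma height_mono: "x \<le> y \<Longrightarrow> height x \<le> height y"
  by (rule height_le) (meson height_ge order_trans)

lemma height_zero: "height 0 = 0"
proof (rule antisym)
  show "height 0 \<le> 0"
  proof (rule height_le)
    fix n assume "n \<in> N" "\<phi> n 0 \<le> 0"
    then have "\<tau> n \<le> \<tau> \<one>"
      by (intro tau_mono) (auto simp: somewhere_le_def intro!: exI[of _ 0])
    then show "\<tau> n \<le> 0" by (simp add: tau_one)
  qed
  show "0 \<le> height 0"
    using height_ge[of \<one> 0] by (simp add: tau_one)
qed

lemma height_translate:
  assumes m: "m \<in> N"
  shows "height (\<phi> m x) = \<tau> m + height x"
proof -
  have ge: "\<tau> m + height x \<le> height (\<phi> m x)" if m: "m \<in> N" for m x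
  proof -
    have [simp]: "m \<in> carrier G" using m by (rule mem_carrier)
    have "height x \<le> height (\<phi> m x) - \<tau> m"
    proof (rule height_le)
      fix n assume n: "n \<in> N" "\<phi> n 0 \<le> x"
      then have "\<phi> (m \<otimes> n) 0 \<le> \<phi> m x"
        using mem_carrier by (simp add: act_mult)
      then have "\<tau> (m \<otimes> n) \<le> height (\<phi> m x)"
        using m n by (intro height_ge) auto
      then show "\<tau> n \<le> height (\<phi> m x) - \<tau> m"
        using m n by (simp add: tau_mult)
    qed
    then show ?thesis by simp
  qed
  have "\<tau> (inv m) + height (\<phi> m x) \<le> height (\<phi> (inv m) (\<phi> m x))"
    using m by (intro ge) auto
  then show ?thesis
    using ge[OF m, of x] m by (simp add: tau_pow mem_carrier)
qed

text \<open>
  The formula holds on the orbit of \<open>0\<close> under \<open>N\<close> by \<open>tau_conj\<close>. Heights of orbit points are dense,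
  so monotonicity extends it to all points.
\<close>

lemma height_act:
  assumes g: "g \<in> carrier G" and g0: "g0 \<in> carrier G" "1 < multiplier g0"
  shows "height (\<phi> g x) = multiplier g * height x + height (\<phi> g 0)"
proof -
  note pos = multiplier_pos[OF g]
  \<comment> \<open>The height that \<open>x\<close> would need for the formula to hold.\<close>
  define r where "r = (height (\<phi> g x) - height (\<phi> g 0)) / multiplier g"
  have r: "height (\<phi> g x) = multiplier g * r + height (\<phi> g 0)"
    using pos by (simp add: r_def)
  have conj: "height (\<phi> g (\<phi> n 0)) = multiplier g * \<tau> n + height (\<phi> g 0)" if n: "n \<in> N" for n
  proof -
    have "\<phi> g (\<phi> n 0) = \<phi> (g \<otimes> n \<otimes> inv g) (\<phi> g 0)"
      using g n by (simp add: act_mult mem_carrier)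
    then show ?thesis
      using height_translate[OF conj_mem[OF n g]] tau_conj[OF g n] by simp
  qed
  have "r = height x"
  proof (rule linorder_cases)
    assume "r < height x"
    then obtain n where n: "n \<in> N" "r < \<tau> n" "\<tau> n < height x"
      using tau_dense[OF g0] by metis
    then have "\<phi> n 0 \<le> x"
      by (intro act_le_if_tau_less_height)
    then have "height (\<phi> g (\<phi> n 0)) \<le> height (\<phi> g x)"
      using g by (intro height_mono) simp
    then show ?thesis
      using n pos by (simp add: conj r)
  next
    assume "height x < r"
    then obtain n where n: "n \<in> N" "height x < \<tau> n" "\<tau> n < r"
      using tau_dense[OF g0] by metis
    then have "x \<le> \<phi> n 0"
      using height_ge[of n x] by linarith
    then have "height (\<phi> g x) \<le> height (\<phi> g (\<phi> n 0))"
      using g by (intro height_mono) simp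
    then show ?thesis
      using n pos by (simp add: conj r)
  qed
  then show ?thesis using r by simp
qed

end

lemma (in thue_morse_action) height_function_exists:
  assumes s: "s \<in> N" "\<And>t. t < \<phi> s t"
    and g0: "g0 \<in> carrier G" "\<phi> (s \<otimes> s) a \<le> \<phi> (g0 \<otimes> s \<otimes> inv g0) a"
  obtains \<alpha> \<beta> :: "'a \<Rightarrow> real" and h :: "real \<Rightarrow> real"
  where "mono h" "\<And>g x. g \<in> carrier G \<Longrightarrow> h (\<phi> g x) = \<alpha> g * h x + \<beta> g"
    "\<And>g. g \<in> carrier G \<Longrightarrow> 0 < \<alpha> g"
    "\<And>g k. g \<in> carrier G \<Longrightarrow> k \<in> carrier G \<Longrightarrow> \<alpha> (g \<otimes> k) = \<alpha> g * \<alpha> k \<and> \<beta> (g \<otimes> k) = \<alpha> g * \<beta> k + \<beta> g"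
    "\<alpha> s = 1" "\<beta> s = 1" "\<alpha> g0 \<noteq> 1"
proof -
  obtain \<tau> where tau: "translation_number G \<phi> N c \<tau> s"
    using translation_number_exists[OF s] by blast
  interpret T: translation_number G \<phi> N c \<tau> s
    by (rule tau)
  have "\<tau> (s \<otimes> s) \<le> \<tau> (g0 \<otimes> s \<otimes> inv g0)"
    using g0 s by (intro T.tau_mono conj_mem) (auto simp: somewhere_le_def)
  then have "2 \<le> T.multiplier g0"
    using s by (simp add: T.multiplier_def T.tau_mult T.tau_s)
  then have big: "1 < T.multiplier g0" by simp
  note act = T.height_act[OF _ g0(1) big]
  show thesis
  proof (rule that[of T.height T.multiplier "\<lambda>g. T.height (\<phi> g 0)"])
    show "mono T.height"
      using T.height_mono by (rule monoI)
    show "T.height (\<phi> s 0) = 1"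
      using T.height_translate[OF s(1)] T.tau_s T.height_zero by simp
    fix g k assume "g \<in> carrier G" "k \<in> carrier G"
    then show "T.multiplier (g \<otimes> k) = T.multiplier g * T.multiplier k \<and>
        T.height (\<phi> (g \<otimes> k) 0) = T.multiplier g * T.height (\<phi> k 0) + T.height (\<phi> g 0)"
      using T.multiplier_mult act[of g "\<phi> k 0"] by (simp add: act_mult)
  next
    show "T.multiplier g0 \<noteq> 1"
      using big by simp
  qed (fact act T.multiplier_pos T.multiplier_s)+
qed

section \<open>Affine actions of virtually metanilpotent groups\<close>

text \<open>
  By the pigeonhole principle two powers of \<open>x\<close> lie in the same coset.
\<close>

lemma (in group) pow_mem_finite_index:
  assumes H: "subgroup H G" "finite (rcosets H)" and x: "x \<in> carrier G"
  obtains i :: nat where "0 < i" "x [^] i \<in> H"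
proof -
  have "range (\<lambda>i::nat. H #> x [^] i) \<subseteq> rcosets H"
    using x by (auto simp: RCOSETS_def)
  then have "finite (range (\<lambda>i::nat. H #> x [^] i))"
    using H finite_subset by blast
  then have "\<not> inj (\<lambda>i::nat. H #> x [^] i)"
    using finite_imageD infinite_UNIV_nat by blast
  then obtain i j :: nat where "i \<noteq> j" "H #> x [^] i = H #> x [^] j"
    by (auto simp: inj_def)
  then obtain i j :: nat where ij: "i < j" "H #> x [^] i = H #> x [^] j"
    by (metis linorder_neqE_nat)
  then have "x [^] j \<in> H #> x [^] i"
    using rcos_self[of "x [^] j" H] x H by simp
  then obtain h where h: "h \<in> H" "x [^] j = h \<otimes> x [^] i"
    by (auto simp: r_coset_def)
  have hc: "h \<in> carrier G"
    using h H subgroup.mem_carrier by metis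
  have "x [^] (j - i) \<otimes> x [^] i = h \<otimes> x [^] i"
    using ij x h by (simp add: nat_pow_mult)
  then have "x [^] (j - i) = h"
    using x hc by simp
  with h ij show thesis by (intro that[of "j - i"]) auto
qed

text \<open>
  Suitable powers of \<open>x\<close> and \<open>y\<close> fall into the finite-index nilpotent subgroup of the quotient, and there the
  Thue-Morse law applies; in \<open>G\<close> it holds up to a factor in \<open>N\<close>. The exponent \<open>m\<close> is
  followed by an arbitrary exponent \<open>k\<close> since ping-pong needs high powers.
\<close>

lemma virtually_nilpotent_quotient_law:
  fixes G (structure)
  assumes G: "group G" and N: "N \<lhd> G" and VN: "virtually_nilpotent_group (G Mod N)"
  obtains c where "\<And>x y. x \<in> carrier G \<Longrightarrow> y \<in> carrier G \<Longrightarrow>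
    \<exists>m::nat>0. \<forall>k::nat. \<exists>n\<in>N.
      thue_morse G ((x [^] m) [^] k) ((y [^] m) [^] k) c =
      n \<otimes> thue_morse G ((y [^] m) [^] k) ((x [^] m) [^] k) c"
proof -
  interpret group G by fact
  interpret normal N G by fact
  define Q where "Q = G Mod N"
  interpret Q: group Q
    unfolding Q_def by (rule factorgroup_is_group)
  obtain H where H: "subgroup H Q" "finite (rcosets\<^bsub>Q\<^esub> H)" and nil: "nilpotent_group (Q\<lparr>carrier := H\<rparr>)"
    using VN by (auto simp: virtually_nilpotent_group_def Q_def)
  interpret H: subgroup H Q by (rule H)
  obtain c where c: "\<And>x y. x \<in> H \<Longrightarrow> y \<in> H \<Longrightarrow> thue_morse Q x y c = thue_morse Q y x c"
    using nilpotent_thue_morse_law[OF nil] by (auto simp: thue_morse_subgroup)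
  define \<pi> where "\<pi> = (\<lambda>x. N #> x)"
  have \<pi>: "\<pi> \<in> hom G Q"
    unfolding \<pi>_def Q_def by (rule r_coset_hom_Mod)
  have \<pi>_pow: "\<pi> (x [^] (k::nat)) = \<pi> x [^]\<^bsub>Q\<^esub> k" if "x \<in> carrier G" for x k
    using hom_nat_pow[OF \<pi> that] is_group Q.is_group by simp
  have H_pow: "h [^]\<^bsub>Q\<^esub> (k::nat) \<in> H" if "h \<in> H" for h k
    by (induction k) (use that in auto)
  show thesis
  proof (rule that)
    fix x y assume xy: "x \<in> carrier G" "y \<in> carrier G"
    then have "\<pi> x \<in> carrier Q" "\<pi> y \<in> carrier Q"
      using hom_in_carrier[OF \<pi>] by auto
    then obtain i j :: nat where ij: "0 < i" "\<pi> x [^]\<^bsub>Q\<^esub> i \<in> H" "0 < j" "\<pi> y [^]\<^bsub>Q\<^esub> j \<in> H"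
      using Q.pow_mem_finite_index[OF H] by metis
    have xH: "\<pi> ((x [^] (i * j)) [^] k) \<in> H" for k :: nat
      using H_pow[OF ij(2), of "j * k"] xy \<open>\<pi> x \<in> carrier Q\<close>
      by (simp add: \<pi>_pow nat_pow_pow Q.nat_pow_pow mult.assoc)
    have yH: "\<pi> ((y [^] (i * j)) [^] k) \<in> H" for k :: nat
      using H_pow[OF ij(4), of "i * k"] xy \<open>\<pi> y \<in> carrier Q\<close>
      by (simp add: \<pi>_pow nat_pow_pow Q.nat_pow_pow mult.assoc mult.left_commute)
    show "\<exists>m::nat>0. \<forall>k::nat. \<exists>n\<in>N.
      thue_morse G ((x [^] m) [^] k) ((y [^] m) [^] k) c =
      n \<otimes> thue_morse G ((y [^] m) [^] k) ((x [^] m) [^] k) c"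
    proof (intro exI[of _ "i * j"] conjI allI)
      show "0 < i * j" using ij by simp
      fix k :: nat
      define u v where "u = (x [^] (i * j)) [^] k" and "v = (y [^] (i * j)) [^] k"
      have uv: "u \<in> carrier G" "v \<in> carrier G"
        using xy by (auto simp: u_def v_def)
      have "\<pi> (thue_morse G u v c) = \<pi> (thue_morse G v u c)"
        using c[OF xH[of k] yH[of k]] uv
        by (simp add: hom_thue_morse[OF is_group \<pi>] flip: u_def v_def)
      then have "thue_morse G u v c \<in> N #> thue_morse G v u c"
        unfolding \<pi>_def using rcos_self[OF thue_morse_closed[OF uv, of c] subgroup_axioms] by simp
      then show "\<exists>n\<in>N. thue_morse G u v c = n \<otimes> thue_morse G v u c"
        by (auto simp: r_coset_def)
    qed
  qed
qed

context line_action
begin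

lemma contraction_pow:
  assumes x: "x \<in> carrier G" and "\<And>t. \<phi> x t = a * (t - p) + p"
  shows "\<phi> (x [^] (k::nat)) t = a ^ k * (t - p) + p"
  by (induction k arbitrary: t) (use assms in \<open>simp_all add: act_mult\<close>)

text \<open>
  If \<open>p < q\<close>, then high powers of the two contractions map \<open>[p, q]\<close> into its left and its right
  half: ping-pong.
\<close>

lemma contractions_share_fixed_point:
  assumes x: "x \<in> carrier G" "\<And>t. \<phi> x t = a * (t - p) + p"
    and y: "y \<in> carrier G" "\<And>t. \<phi> y t = b * (t - q) + q"
    and ab: "0 < a" "a < 1" "0 < b" "b < 1"
    and law: "\<And>(k::nat) t. \<phi> (thue_morse G (x [^] k) (y [^] k) c) t = \<phi> (thue_morse G (y [^] k) (x [^] k) c) t"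
  shows "q \<le> p"
proof (rule ccontr)
  assume "\<not> q \<le> p"
  then have pq: "p < q" by simp
  obtain k where k: "max a b ^ k < 1 / 2"
    using real_arch_pow_inv[of "1/2" "max a b"] ab by auto
  have "a ^ k \<le> max a b ^ k" "b ^ k \<le> max a b ^ k"
    using ab by (auto intro!: power_mono)
  with k have half: "a ^ k < 1 / 2" "b ^ k < 1 / 2" by linarith+
  have pos: "0 < a ^ k" "0 < b ^ k" using ab by auto
  note act_x = contraction_pow[OF x, of k] and act_y = contraction_pow[OF y, of k]
  have bx: "p \<le> \<phi> (x [^] k) t" "\<phi> (x [^] k) t < (p + q) / 2" if "t \<in> {p..q}" for t
  proof -
    have "a ^ k * (t - p) \<le> a ^ k * (q - p)" "a ^ k * (q - p) < 1 / 2 * (q - p)" "0 \<le> a ^ k * (t - p)"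
      using that pos half pq by (auto intro!: mult_left_mono mult_strict_right_mono)
    then show "p \<le> \<phi> (x [^] k) t" "\<phi> (x [^] k) t < (p + q) / 2"
      by (simp_all add: act_x field_simps)
  qed
  have by': "\<phi> (y [^] k) t \<le> q" "(p + q) / 2 < \<phi> (y [^] k) t" if "t \<in> {p..q}" for t
  proof -
    have "b ^ k * (q - t) \<le> b ^ k * (q - p)" "b ^ k * (q - p) < 1 / 2 * (q - p)" "0 \<le> b ^ k * (q - t)"
      using that pos half pq by (auto intro!: mult_left_mono mult_strict_right_mono)
    then show "\<phi> (y [^] k) t \<le> q" "(p + q) / 2 < \<phi> (y [^] k) t"
      by (simp_all add: act_y field_simps)
  qed
  show False
  proof (rule no_ping_pong[where x = "x [^] k" and y = "y [^] k" and c = c and I = "{p..q}" and ?t0.0 = p])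
    show "\<phi> (x [^] k) t \<in> {p..q}" if "t \<in> {p..q}" for t
      using bx[OF that] pq by simp
    show "\<phi> (y [^] k) t \<in> {p..q}" if "t \<in> {p..q}" for t
      using by'[OF that] pq by simp
    show "\<phi> (x [^] k) t < \<phi> (y [^] k) u" if "t \<in> {p..q}" "u \<in> {p..q}" for t u
      using bx[OF that(1)] by'[OF that(2)] by simp
  qed (use x y pq law in auto)
qed

end

locale affine_line_action = line_action +
  fixes \<alpha> \<beta> :: "'a \<Rightarrow> real"
  assumes affine: "g \<in> carrier G \<Longrightarrow> \<phi> g t = \<alpha> g * t + \<beta> g"
    and \<alpha>_pos: "g \<in> carrier G \<Longrightarrow> 0 < \<alpha> g"
    and irreducible: "\<exists>g\<in>carrier G. \<phi> g t \<noteq> t"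
begin

lemma affine_mult:
  assumes "g \<in> carrier G" "k \<in> carrier G"
  shows "\<alpha> (g \<otimes> k) = \<alpha> g * \<alpha> k" "\<beta> (g \<otimes> k) = \<alpha> g * \<beta> k + \<beta> g"
proof -
  have eq: "\<alpha> (g \<otimes> k) * t + \<beta> (g \<otimes> k) = \<alpha> g * (\<alpha> k * t + \<beta> k) + \<beta> g" for t
    using act_mult[OF assms, of t] assms by (simp add: affine)
  from eq[of 0] show "\<beta> (g \<otimes> k) = \<alpha> g * \<beta> k + \<beta> g" by simp
  with eq[of 1] show "\<alpha> (g \<otimes> k) = \<alpha> g * \<alpha> k" by (simp add: algebra_simps)
qed

lemma \<alpha>_one: "\<alpha> \<one> = 1"
  using affine_mult(1)[of \<one> \<one>] \<alpha>_pos[of \<one>] by simp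

lemma \<alpha>_inv: "g \<in> carrier G \<Longrightarrow> \<alpha> (inv g) * \<alpha> g = 1"
  using affine_mult(1)[of "inv g" g] by (simp add: \<alpha>_one)

lemma \<alpha>_pow: "g \<in> carrier G \<Longrightarrow> \<alpha> (g [^] (k::nat)) = \<alpha> g ^ k"
  by (induction k) (simp_all add: \<alpha>_one affine_mult)

lemma fixed_point_form:
  assumes "g \<in> carrier G" "\<alpha> g \<noteq> 1"
  shows "\<phi> g t = \<alpha> g * (t - \<beta> g / (1 - \<alpha> g)) + \<beta> g / (1 - \<alpha> g)"
proof -
  have "\<beta> g / (1 - \<alpha> g) * (1 - \<alpha> g) = \<beta> g"
    using assms by simp
  then show ?thesis
    unfolding affine[OF assms(1)] by (simp only: right_diff_distrib mult.right_neutral) argo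
qed

text \<open>
  Since no point is fixed by the whole group, some conjugate of a contraction has another fixed
  point.
\<close>

lemma two_contractions:
  assumes g: "g \<in> carrier G" "\<alpha> g \<noteq> 1"
  obtains e k p q where "e \<in> {g, inv g}" "k \<in> carrier G" "p \<noteq> q" "\<alpha> e < 1"
    "\<And>t. \<phi> e t = \<alpha> e * (t - p) + p" "\<And>t. \<phi> (k \<otimes> e \<otimes> inv k) t = \<alpha> e * (t - q) + q"
proof -
  define e where "e = (if \<alpha> g < 1 then g else inv g)"
  have e: "e \<in> {g, inv g}" "e \<in> carrier G" using g by (auto simp: e_def)
  have e1: "\<alpha> e < 1"
  proof (cases "\<alpha> g < 1")
    case False
    then have "1 < \<alpha> g" using g by simp
    moreover have "\<alpha> (inv g) = 1 / \<alpha> g"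
      using \<alpha>_inv[OF g(1)] \<alpha>_pos[OF g(1)] by (simp add: field_simps)
    ultimately show ?thesis using False by (simp add: e_def)
  qed (simp add: e_def)
  define p where "p = \<beta> e / (1 - \<alpha> e)"
  have ep: "\<phi> e t = \<alpha> e * (t - p) + p" for t
    using fixed_point_form[of e t] e e1 by (simp add: p_def)
  obtain k where k: "k \<in> carrier G" "\<phi> k p \<noteq> p"
    using irreducible by blast
  have "\<phi> (k \<otimes> e \<otimes> inv k) t = \<alpha> e * (t - \<phi> k p) + \<phi> k p" for t
  proof -
    define u where "u = \<phi> (inv k) t"
    have t: "t = \<alpha> k * u + \<beta> k"
      using act_act_inv[OF k(1), of t] k by (simp add: u_def affine)
    have "\<phi> (k \<otimes> e \<otimes> inv k) t = \<phi> k (\<phi> e u)"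
      using e k by (simp add: act_mult u_def)
    also have "\<dots> = \<alpha> k * (\<alpha> e * (u - p) + p) + \<beta> k"
      using k by (simp add: ep affine)
    also have "\<dots> = \<alpha> e * (t - \<phi> k p) + \<phi> k p"
      using k by (simp add: t affine algebra_simps)
    finally show ?thesis .
  qed
  then show thesis
    by (intro that[of e k p "\<phi> k p"]) (use e e1 ep k in auto)
qed

lemma contractions_break_law:
  assumes x: "x \<in> carrier G" "\<And>t. \<phi> x t = a * (t - p) + p"
    and y: "y \<in> carrier G" "\<And>t. \<phi> y t = a * (t - q) + q"
    and a: "0 < a" "a < 1" and pq: "p \<noteq> q"
    and law: "\<And>(k::nat) t. \<phi> (thue_morse G (x [^] k) (y [^] k) c) t = \<phi> (thue_morse G (y [^] k) (x [^] k) c) t"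
  shows False
  using contractions_share_fixed_point[OF x y a a law] contractions_share_fixed_point[OF y x a a law[symmetric]] pq
  by simp

lemma nilpotent_normal_acts_by_translations:
  assumes N: "N \<lhd> G" and law: "\<And>x y. x \<in> N \<Longrightarrow> y \<in> N \<Longrightarrow> thue_morse G x y c = thue_morse G y x c"
    and n: "n \<in> N"
  shows "\<alpha> n = 1"
proof (rule ccontr)
  assume ne: "\<alpha> n \<noteq> 1"
  interpret N: thue_morse_action G \<phi> N c
    by (intro thue_morse_action.intro line_action_axioms N thue_morse_action_axioms.intro law)
  have nc: "n \<in> carrier G" using n by (rule N.mem_carrier)
  obtain e k p q where e: "e \<in> {n, inv n}" "k \<in> carrier G" "p \<noteq> q" "\<alpha> e < 1"
      and act: "\<And>t. \<phi> e t = \<alpha> e * (t - p) + p" "\<And>t. \<phi> (k \<otimes> e \<otimes> inv k) t = \<alpha> e * (t - q) + q"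
    using two_contractions[OF nc ne] by metis
  have eN: "e \<in> N" "k \<otimes> e \<otimes> inv k \<in> N"
    using e n N.conj_mem by auto
  show False
  proof (rule contractions_break_law[OF _ act(1) _ act(2)])
    show "\<phi> (thue_morse G (e [^] i) ((k \<otimes> e \<otimes> inv k) [^] i) c) t =
        \<phi> (thue_morse G ((k \<otimes> e \<otimes> inv k) [^] i) (e [^] i) c) t" for i :: nat and t
      using eN law N.pow_mem by simp
  qed (use e eN \<alpha>_pos N.mem_carrier in auto)
qed

text \<open>
  If \<open>N\<close> acted trivially, the action would satisfy the law of the virtually nilpotent quotient, which
  excludes powers of two contractions with different fixed points.
\<close>

lemma nontrivial_on_metanilpotent_kernel:
  assumes N: "N \<lhd> G" and VN: "virtually_nilpotent_group (G Mod N)" and g: "g \<in> carrier G" "\<alpha> g \<noteq> 1"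
  shows "\<exists>n\<in>N. \<exists>t. \<phi> n t \<noteq> t"
proof (rule ccontr)
  assume "\<not> ?thesis"
  then have triv: "\<phi> n t = t" if "n \<in> N" for n t using that by blast
  obtain c where c: "\<And>x y. x \<in> carrier G \<Longrightarrow> y \<in> carrier G \<Longrightarrow>
    \<exists>m::nat>0. \<forall>k::nat. \<exists>n\<in>N. thue_morse G ((x [^] m) [^] k) ((y [^] m) [^] k) c =
      n \<otimes> thue_morse G ((y [^] m) [^] k) ((x [^] m) [^] k) c"
    using virtually_nilpotent_quotient_law[OF is_group N VN] by blast
  obtain e k p q where e: "e \<in> {g, inv g}" "k \<in> carrier G" "p \<noteq> q" "\<alpha> e < 1"
      and act: "\<And>t. \<phi> e t = \<alpha> e * (t - p) + p" "\<And>t. \<phi> (k \<otimes> e \<otimes> inv k) t = \<alpha> e * (t - q) + q"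
    using two_contractions[OF g] by metis
  define f where "f = k \<otimes> e \<otimes> inv k"
  have ef: "e \<in> carrier G" "f \<in> carrier G"
    using e g by (auto simp: f_def)
  obtain m :: nat where m: "0 < m"
    and law: "\<And>i::nat. \<exists>n\<in>N. thue_morse G ((e [^] m) [^] i) ((f [^] m) [^] i) c =
      n \<otimes> thue_morse G ((f [^] m) [^] i) ((e [^] m) [^] i) c"
    using c[OF ef] by blast
  show False
  proof (rule contractions_break_law[where x = "e [^] m" and y = "f [^] m" and a = "\<alpha> e ^ m" and p = p and q = q
        and c = c])
    show "\<phi> (e [^] m) t = \<alpha> e ^ m * (t - p) + p" for t
      by (rule contraction_pow) (use ef act in auto)
    show "\<phi> (f [^] m) t = \<alpha> e ^ m * (t - q) + q" for t
      by (rule contraction_pow) (use ef act in \<open>auto simp: f_def\<close>)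
    show "\<phi> (thue_morse G ((e [^] m) [^] i) ((f [^] m) [^] i) c) t =
        \<phi> (thue_morse G ((f [^] m) [^] i) ((e [^] m) [^] i) c) t" for i :: nat and t
    proof -
      obtain n where n: "n \<in> N" "thue_morse G ((e [^] m) [^] i) ((f [^] m) [^] i) c =
          n \<otimes> thue_morse G ((f [^] m) [^] i) ((e [^] m) [^] i) c"
        using law by blast
      moreover have "n \<in> carrier G"
        using N n(1) by (meson normal_imp_subgroup subgroup.mem_carrier)
      ultimately show ?thesis
        using ef triv by (simp add: act_mult thue_morse_closed)
    qed
    show "0 < \<alpha> e ^ m" "\<alpha> e ^ m < 1"
      using \<alpha>_pos[OF ef(1)] e(4) m by (simp_all add: power_less_one_iff)
  qed (use ef e in auto)
qed

end

section \<open>Openness\<close>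

lemma Hom_irr_line_action:
  assumes "group G" "\<phi> \<in> Hom_irr G"
  shows "line_action G \<phi>"
proof -
  interpret group G by fact
  have hom: "\<phi> \<in> hom G Homeo0"
    using assms by (simp add: Hom_irr_def)
  have carr: "\<phi> x \<in> carrier Homeo0" if "x \<in> carrier G" for x
    using hom_in_carrier[OF hom that] .
  show ?thesis
  proof unfold_locales
    fix x assume x: "x \<in> carrier G"
    show "strict_mono (\<phi> x)" "continuous_on UNIV (\<phi> x)"
      using carr[OF x] by (auto simp: Homeo0_def homeomorphism_def)
    show "\<phi> (x \<otimes>\<^bsub>G\<^esub> y) t = \<phi> x (\<phi> y t)" if "y \<in> carrier G" for y t
      using hom_mult[OF hom x that] by (simp add: Homeo0_def)
  qed
qed

lemma nonabelian_affine_action_coefficients: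
  assumes G: "group G" and \<psi>: "nonabelian_affine_action G \<psi>" "\<psi> \<in> Hom_irr G"
  obtains \<alpha> \<beta> g where "affine_line_action G \<psi> \<alpha> \<beta>" "g \<in> carrier G" "\<alpha> g \<noteq> 1"
proof -
  interpret line_action G \<psi>
    by (rule Hom_irr_line_action[OF G \<psi>(2)])
  have "\<psi> g \<in> Aff" if "g \<in> carrier G" for g
    using \<psi>(1) hom_in_carrier[of \<psi> G "Homeo0\<lparr>carrier := Aff\<rparr>" g] that
    by (simp add: nonabelian_affine_action_def)
  then have "\<forall>g\<in>carrier G. \<exists>a b. 0 < a \<and> \<psi> g = (\<lambda>t. a * t + b)"
    unfolding Aff_def by blast
  then obtain \<alpha> \<beta> where ab: "\<And>g. g \<in> carrier G \<Longrightarrow> 0 < \<alpha> g" "\<And>g. g \<in> carrier G \<Longrightarrow> \<psi> g = (\<lambda>t. \<alpha> g * t + \<beta> g)"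
    by metis
  have "affine_line_action G \<psi> \<alpha> \<beta>"
  proof unfold_locales
    show "\<exists>g\<in>carrier G. \<psi> g t \<noteq> t" for t
      using \<psi>(2) by (auto simp: Hom_irr_def)
  qed (use ab in auto)
  moreover have "\<exists>g\<in>carrier G. \<alpha> g \<noteq> 1"
  proof (rule ccontr)
    assume "\<not> ?thesis"
    then have "\<psi> g = (\<lambda>t. t + \<beta> g)" if "g \<in> carrier G" for g
      using ab(2)[OF that] that by auto
    then have "\<psi> g \<circ> \<psi> k = \<psi> k \<circ> \<psi> g" if "g \<in> carrier G" "k \<in> carrier G" for g k
      using that by (simp add: fun_eq_iff)
    then show False
      using \<psi>(1) by (auto simp: nonabelian_affine_action_def)
  qed
  ultimately show thesis using that by blast
qed

lemma (in affine_line_action) multiplier_gt_2: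
  assumes g: "g \<in> carrier G" "\<alpha> g \<noteq> 1"
  obtains g0 where "g0 \<in> carrier G" "2 < \<alpha> g0"
proof -
  obtain e where e: "e \<in> carrier G" "1 < \<alpha> e"
  proof (cases "1 < \<alpha> g")
    case False
    then have "\<alpha> g < 1" using g by simp
    moreover have "\<alpha> (inv g) = 1 / \<alpha> g"
      using \<alpha>_inv[OF g(1)] \<alpha>_pos[OF g(1)] by (simp add: field_simps)
    ultimately show ?thesis
      using that[of "inv g"] g \<alpha>_pos[OF g(1)] by simp
  qed (use g that in blast)
  obtain k where "2 < \<alpha> e ^ k"
    using real_arch_pow[OF e(2)] by blast
  then show thesis
    using that[of "e [^] k"] e by (simp add: \<alpha>_pow)
qed

text \<open>
  Pull the affine picture back along the semi-conjugacy. A weakly monotone \<open>h\<close> reflects strict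
  inequalities, so strict inequalities between values of \<open>h\<close> become strict inequalities on
  the line.
\<close>

lemma detect_expanded_translation:
  fixes G (structure)
  assumes G: "group G" and N: "N \<lhd> G" and NN: "nilpotent_group (G\<lparr>carrier := N\<rparr>)"
    and VN: "virtually_nilpotent_group (G Mod N)"
    and \<psi>: "nonabelian_affine_action G \<psi>" and sc: "semi_conjugate G \<phi> \<psi>"
  obtains s g0 where "s \<in> N" "g0 \<in> carrier G" "\<And>t. t < \<phi> s t"
    "\<phi> (s \<otimes> s) 0 < \<phi> (g0 \<otimes> s \<otimes> inv g0) 0"
proof -
  have irr: "\<phi> \<in> Hom_irr G" "\<psi> \<in> Hom_irr G"
    using sc by (auto simp: semi_conjugate_def)
  obtain \<alpha> \<beta> g where aff: "affine_line_action G \<psi> \<alpha> \<beta>" and g: "g \<in> carrier G" "\<alpha> g \<noteq> 1"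
    by (rule nonabelian_affine_action_coefficients[OF G \<psi> irr(2)])
  interpret affine_line_action G \<psi> \<alpha> \<beta> by (rule aff)
  interpret A: line_action G \<phi> by (rule Hom_irr_line_action[OF G irr(1)])
  interpret N: normal N G by (rule N)
  obtain c where law: "\<And>x y. x \<in> N \<Longrightarrow> y \<in> N \<Longrightarrow> thue_morse G x y c = thue_morse G y x c"
    using nilpotent_thue_morse_law[OF NN] by (auto simp: thue_morse_subgroup)
  have trans: "\<alpha> n = 1" if "n \<in> N" for n
    by (rule nilpotent_normal_acts_by_translations[OF N law that])
  obtain n t where n: "n \<in> N" "\<psi> n t \<noteq> t"
    using nontrivial_on_metanilpotent_kernel[OF N VN g] by blast
  then have \<beta>n: "\<beta> n \<noteq> 0"
    using trans[OF n(1)] by (simp add: affine N.mem_carrier)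
  have \<beta>_inv: "\<beta> (inv n) = - \<beta> n"
    using affine_mult(2)[of "inv n" n] affine_mult(2)[of \<one> \<one>] n trans[of "inv n"]
    by (simp add: N.mem_carrier \<alpha>_one)
  obtain h0 where h0: "mono h0 \<or> antimono h0" "\<And>g x. g \<in> carrier G \<Longrightarrow> h0 (\<phi> g x) = \<alpha> g * h0 x + \<beta> g"
    using sc by (auto simp: semi_conjugate_def fun_eq_iff affine)
  \<comment> \<open>The sign turns a decreasing semi-conjugacy into an increasing one, at the price of reflecting
    the affine action.\<close>
  define \<epsilon> :: real where "\<epsilon> = (if mono h0 then 1 else - 1)"
  define h where "h = (\<lambda>x. \<epsilon> * h0 x)"
  have \<epsilon>: "\<epsilon> \<noteq> 0" by (simp add: \<epsilon>_def)
  have h_mono: "h x \<le> h y" if "x \<le> y" for x y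
    using h0(1) that by (auto simp: h_def \<epsilon>_def monoD antimonoD)
  have h: "h (\<phi> g x) = \<alpha> g * h x + \<epsilon> * \<beta> g" if "g \<in> carrier G" for g x
    using h0(2)[OF that] by (simp add: h_def algebra_simps)
  define s where "s = (if 0 < \<epsilon> * \<beta> n then n else inv n)"
  have s: "s \<in> N" "s \<in> carrier G"
    using n(1) by (auto simp: s_def N.mem_carrier)
  have \<beta>s: "0 < \<epsilon> * \<beta> s"
    using \<beta>n \<epsilon> \<beta>_inv by (auto simp: s_def not_less le_less)
  have h_s: "h (\<phi> s x) = h x + \<epsilon> * \<beta> s" for x
    using h[OF s(2)] trans[OF s(1)] by simp
  obtain g0 where g0: "g0 \<in> carrier G" "2 < \<alpha> g0"
    using multiplier_gt_2[OF g] .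
  show thesis
  proof (rule that[OF s(1) g0(1)])
    show "t < \<phi> s t" for t
      using h_mono[of "\<phi> s t" t] h_s[of t] \<beta>s by force
    define u where "u = \<phi> (inv g0) 0"
    have "h 0 = \<alpha> g0 * h u + \<epsilon> * \<beta> g0"
      using h[OF g0(1), of u] g0 by (simp add: u_def)
    then have "h (\<phi> (g0 \<otimes> s \<otimes> inv g0) 0) = h 0 + \<alpha> g0 * (\<epsilon> * \<beta> s)"
      using g0 s h[OF g0(1), of "\<phi> s u"] by (simp add: A.act_mult h_s algebra_simps flip: u_def)
    moreover have "h (\<phi> (s \<otimes> s) 0) = h 0 + 2 * (\<epsilon> * \<beta> s)"
      using s by (simp add: A.act_mult h_s)
    moreover have "2 * (\<epsilon> * \<beta> s) < \<alpha> g0 * (\<epsilon> * \<beta> s)"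
      using g0(2) \<beta>s by (rule mult_strict_right_mono)
    ultimately have "h (\<phi> (s \<otimes> s) 0) < h (\<phi> (g0 \<otimes> s \<otimes> inv g0) 0)"
      by simp
    then show "\<phi> (s \<otimes> s) 0 < \<phi> (g0 \<otimes> s \<otimes> inv g0) 0"
      using h_mono by (meson leD leI)
  qed
qed

text \<open>
  Apart from being an irreducible action, \<open>\<phi>\<close> is only required to satisfy strict inequalities between images of \<open>0\<close>, that is,
  open conditions.
\<close>

lemma expanded_translation_imp_affine:
  fixes G :: "('a, 'b) monoid_scheme" (structure)
  assumes G: "group G" and irr: "\<phi> \<in> Hom_irr G" and "thue_morse_action G \<phi> N c"
    and s: "s \<in> N" "0 < \<phi> s 0"
    and g0: "g0 \<in> carrier G" "\<phi> (s \<otimes> s) 0 < \<phi> (g0 \<otimes> s \<otimes> inv g0) 0"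
    and S: "S \<subseteq> carrier G" "generate G S = carrier G" "\<And>g. g \<in> S \<Longrightarrow> inv g \<in> S"
    and bounds: "\<And>g f. g \<in> S \<Longrightarrow> f \<in> {g, g \<otimes> s \<otimes> inv g, g \<otimes> inv s \<otimes> inv g} \<Longrightarrow>
      (\<exists>m::nat. \<phi> (inv s [^] m) 0 < \<phi> f 0) \<and> (\<exists>m::nat. \<phi> f 0 < \<phi> (s [^] m) 0)"
  obtains \<psi> where "nonabelian_affine_action G \<psi>" "semi_conjugate G \<phi> \<psi>"
proof -
  interpret thue_morse_action G \<phi> N c by fact
  have sc: "s \<in> carrier G" using s by (auto simp: mem_carrier)
  have "\<not> (\<exists>d. \<forall>g\<in>carrier G. \<phi> g d = d)"
    using irr by (simp add: Hom_irr_def)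
  then have free: "t < \<phi> s t" for t
    by (rule free_if_irreducible[OF _ s S bounds])
  show thesis
  proof (rule height_function_exists[OF s(1) free g0(1) less_imp_le[OF g0(2)]])
    fix \<alpha> \<beta> :: "'a \<Rightarrow> real" and h :: "real \<Rightarrow> real"
    assume h: "mono h" "\<And>g x. g \<in> carrier G \<Longrightarrow> h (\<phi> g x) = \<alpha> g * h x + \<beta> g"
      and pos: "\<And>g. g \<in> carrier G \<Longrightarrow> 0 < \<alpha> g"
      and cocycle: "\<And>g k. g \<in> carrier G \<Longrightarrow> k \<in> carrier G \<Longrightarrow>
        \<alpha> (g \<otimes> k) = \<alpha> g * \<alpha> k \<and> \<beta> (g \<otimes> k) = \<alpha> g * \<beta> k + \<beta> g"
      and ab: "\<alpha> s = 1" "\<beta> s = 1" "\<alpha> g0 \<noteq> 1"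
    define \<psi> where "\<psi> = (\<lambda>g\<in>carrier G. \<lambda>t. \<alpha> g * t + \<beta> g)"
    have \<psi>: "\<psi> g = (\<lambda>t. \<alpha> g * t + \<beta> g)" if "g \<in> carrier G" for g
      using that by (simp add: \<psi>_def)
    have Aff: "\<psi> g \<in> Aff" if "g \<in> carrier G" for g
      using pos[OF that] \<psi>[OF that] by (auto simp: Aff_def)
    have mult: "\<psi> (g \<otimes> k) = \<psi> g \<circ> \<psi> k" if "g \<in> carrier G" "k \<in> carrier G" for g k
      using that cocycle[OF that] by (simp add: \<psi> fun_eq_iff algebra_simps)
    show thesis
    proof (rule that)
      have "\<psi> g0 \<circ> \<psi> s \<noteq> \<psi> s \<circ> \<psi> g0"
      proof
        assume "\<psi> g0 \<circ> \<psi> s = \<psi> s \<circ> \<psi> g0"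
        from fun_cong[OF this, of 0] show False
          using ab g0 sc by (simp add: \<psi>)
      qed
      moreover have "\<psi> \<in> hom G (Homeo0\<lparr>carrier := Aff\<rparr>)"
        using Aff mult by (intro homI) (simp_all add: Homeo0_def)
      ultimately show "nonabelian_affine_action G \<psi>"
        unfolding nonabelian_affine_action_def using g0 sc by blast
      have "\<psi> \<in> hom G Homeo0"
        using Aff mult Aff_subset_Homeo0 by (intro homI) (auto simp: Homeo0_def)
      moreover have "\<psi> s x \<noteq> x" for x
        using ab sc by (simp add: \<psi>)
      ultimately have "\<psi> \<in> Hom_irr G"
        unfolding Hom_irr_def using sc by (auto simp: \<psi>_def)
      then show "semi_conjugate G \<phi> \<psi>"
        unfolding semi_conjugate_def using irr h by (auto simp: \<psi> fun_eq_iff intro!: exI[of _ h])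
    qed
  qed
qed

lemma continuous_map_evaluate:
  "continuous_map compact_open_Homeo0 euclideanreal (\<lambda>f. f x)"
  unfolding continuous_map_def
proof (intro conjI allI impI)
  fix U :: "real set" assume "openin euclideanreal U"
  then have U: "open U" by simp
  have "{f \<in> topspace compact_open_Homeo0. f x \<in> U} = {f \<in> carrier Homeo0. f ` {x} \<subseteq> U}"
    by auto
  also have "openin compact_open_Homeo0 \<dots>"
    unfolding compact_open_Homeo0_def
    by (intro topology_generated_by_Basis CollectI exI[of _ "{x}"] exI[of _ U] conjI refl U
        finite_imp_compact finite.intros)
  finally show "openin compact_open_Homeo0 {f \<in> topspace compact_open_Homeo0. f x \<in> U}" .
qed auto

lemma continuous_map_Hom_irr_evaluate:
  assumes "g \<in> carrier G"
  shows "continuous_map (Hom_irr_topology G) euclideanreal (\<lambda>\<phi>. \<phi> g x)"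
  unfolding Hom_irr_topology_def
  using continuous_map_compose[OF continuous_map_product_projection[OF assms] continuous_map_evaluate]
  by (intro continuous_map_from_subtopology) (simp add: o_def)

lemma openin_act_less:
  assumes "g \<in> carrier G" "k \<in> carrier G"
  shows "openin (Hom_irr_topology G) {\<phi> \<in> Hom_irr G. \<phi> g x < \<phi> k y}"
proof -
  have "continuous_map (Hom_irr_topology G) euclideanreal (\<lambda>\<phi>. \<phi> k y - \<phi> g x)"
    using assms by (intro continuous_map_diff continuous_map_Hom_irr_evaluate)
  from openin_continuous_map_preimage[OF this, of "{0<..}"] show ?thesis
    by simp
qed

lemma openin_bounded_by_orbit:
  fixes G (structure)
  assumes "group G" "s \<in> carrier G" "f \<in> carrier G"
  shows "openin (Hom_irr_topology G)
    {\<phi> \<in> Hom_irr G. (\<exists>m::nat. \<phi> (inv s [^] m) x < \<phi> f x) \<and> (\<exists>m::nat. \<phi> f x < \<phi> (s [^] m) x)}"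
proof -
  interpret group G by fact
  have "{\<phi> \<in> Hom_irr G. (\<exists>m::nat. \<phi> (inv s [^] m) x < \<phi> f x) \<and> (\<exists>m::nat. \<phi> f x < \<phi> (s [^] m) x)} =
      (\<Union>m::nat. {\<phi> \<in> Hom_irr G. \<phi> (inv s [^] m) x < \<phi> f x}) \<inter>
      (\<Union>m::nat. {\<phi> \<in> Hom_irr G. \<phi> f x < \<phi> (s [^] m) x})"
    by auto
  then show ?thesis
    using assms by (auto intro!: openin_act_less)
qed

theorem theorem3:
  fixes G :: "('a, 'b) monoid_scheme"
  assumes "group G"
    and "finitely_generated_group G"
    and "virtually_metanilpotent_group G"
  shows "openin (Hom_irr_topology G)
    {\<phi> \<in> Hom_irr G. \<exists>\<psi>. nonabelian_affine_action G \<psi> \<and> semi_conjugate G \<phi> \<psi>}"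
proof (subst openin_subopen, intro ballI)
  interpret group G by (rule assms(1))
  let ?A = "{\<phi> \<in> Hom_irr G. \<exists>\<psi>. nonabelian_affine_action G \<psi> \<and> semi_conjugate G \<phi> \<psi>}"
  obtain N where N: "N \<lhd> G" and NN: "nilpotent_group (G\<lparr>carrier := N\<rparr>)"
      and VN: "virtually_nilpotent_group (G Mod N)"
    using assms(3) by (auto simp: virtually_metanilpotent_group_def)
  interpret N: normal N G by (rule N)
  obtain c where law: "\<And>x y. x \<in> N \<Longrightarrow> y \<in> N \<Longrightarrow> thue_morse G x y c = thue_morse G y x c"
    using nilpotent_thue_morse_law[OF NN] by (auto simp: thue_morse_subgroup)
  obtain S0 where S0: "finite S0" "S0 \<subseteq> carrier G" "generate G S0 = carrier G"
    using assms(2) by (auto simp: finitely_generated_group_def)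
  define S where "S = S0 \<union> m_inv G ` S0"
  have S: "finite S" "S \<subseteq> carrier G" "\<And>g. g \<in> S \<Longrightarrow> m_inv G g \<in> S"
    using S0 by (auto simp: S_def subset_iff)
  have gen: "generate G S = carrier G"
    using S0(3) mono_generate[of S0 S] generate_incl[OF S(2)] by (auto simp: S_def)
  fix \<phi>0 assume "\<phi>0 \<in> ?A"
  then obtain \<psi>0 where "\<phi>0 \<in> Hom_irr G" "nonabelian_affine_action G \<psi>0" "semi_conjugate G \<phi>0 \<psi>0"
    by auto
  then obtain s g0 where s: "s \<in> N" and g0: "g0 \<in> carrier G" and free: "\<And>t. t < \<phi>0 s t"
      and expand: "\<phi>0 (s \<otimes>\<^bsub>G\<^esub> s) 0 < \<phi>0 (g0 \<otimes>\<^bsub>G\<^esub> s \<otimes>\<^bsub>G\<^esub> inv\<^bsub>G\<^esub> g0) 0"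
    using detect_expanded_translation[OF assms(1) N NN VN] by metis
  have sc: "s \<in> carrier G" using s by (rule N.mem_carrier)
  define F where "F = (\<Union>g\<in>S. {g, g \<otimes>\<^bsub>G\<^esub> s \<otimes>\<^bsub>G\<^esub> inv\<^bsub>G\<^esub> g, g \<otimes>\<^bsub>G\<^esub> inv\<^bsub>G\<^esub> s \<otimes>\<^bsub>G\<^esub> inv\<^bsub>G\<^esub> g})"
  have F: "finite F" "F \<subseteq> carrier G"
    using S sc by (auto simp: F_def)
  define B where "B = (\<lambda>f. {\<phi> \<in> Hom_irr G.
    (\<exists>m::nat. \<phi> (inv\<^bsub>G\<^esub> s [^]\<^bsub>G\<^esub> m) 0 < \<phi> f 0) \<and> (\<exists>m::nat. \<phi> f 0 < \<phi> (s [^]\<^bsub>G\<^esub> m) 0)})"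
  \<comment> \<open>The unit stands in for \<open>0\<close> in \<open>0 < \<phi> s 0\<close>, which gives this condition the same form as the
    others. The whole space is a factor because \<open>F\<close> may be empty.\<close>
  define U where "U = {\<phi> \<in> Hom_irr G. \<phi> \<one>\<^bsub>G\<^esub> 0 < \<phi> s 0} \<inter>
    ({\<phi> \<in> Hom_irr G. \<phi> (s \<otimes>\<^bsub>G\<^esub> s) 0 < \<phi> (g0 \<otimes>\<^bsub>G\<^esub> s \<otimes>\<^bsub>G\<^esub> inv\<^bsub>G\<^esub> g0) 0} \<inter>
    ((\<Inter>f\<in>F. B f) \<inter> topspace (Hom_irr_topology G)))"
  have "openin (Hom_irr_topology G) ((\<Inter>f\<in>F. B f) \<inter> topspace (Hom_irr_topology G))"
    using F sc openin_bounded_by_orbit[OF assms(1) sc]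
    by (intro openin_INT) (auto simp: B_def subset_iff)
  with sc g0 have "openin (Hom_irr_topology G) U"
    unfolding U_def by (intro openin_Int[OF openin_act_less openin_Int[OF openin_act_less]]) auto
  moreover have "\<phi>0 \<in> U"
  proof -
    interpret line_action G \<phi>0
      by (rule Hom_irr_line_action[OF assms(1) \<open>\<phi>0 \<in> Hom_irr G\<close>])
    have "\<phi>0 \<in> B f" if f: "f \<in> carrier G" for f
    proof -
      obtain m :: nat where "\<phi>0 f 0 < \<phi>0 (s [^]\<^bsub>G\<^esub> m) 0"
        by (rule orbit_passes[of s 0 "\<phi>0 f 0"]) (use sc free in auto)
      moreover obtain l :: nat where "0 < \<phi>0 (s [^]\<^bsub>G\<^esub> l) (\<phi>0 f 0)"
        by (rule orbit_passes[of s "\<phi>0 f 0" 0]) (use sc free in auto)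
      then have "\<phi>0 (inv\<^bsub>G\<^esub> s [^]\<^bsub>G\<^esub> l) 0 < \<phi>0 f 0"
        using sc by (simp add: nat_pow_inv act_inv_less)
      ultimately show ?thesis
        using \<open>\<phi>0 \<in> Hom_irr G\<close> by (auto simp: B_def)
    qed
    then show ?thesis
      using \<open>\<phi>0 \<in> Hom_irr G\<close> free expand F by (auto simp: U_def)
  qed
  moreover have "U \<subseteq> ?A"
  proof
    fix \<phi> assume \<phi>: "\<phi> \<in> U"
    then have irr: "\<phi> \<in> Hom_irr G" by (simp add: U_def)
    interpret line_action G \<phi>
      by (rule Hom_irr_line_action[OF assms(1) irr])
    have "thue_morse_action G \<phi> N c"
      by (intro thue_morse_action.intro line_action_axioms N thue_morse_action_axioms.intro law)
    moreover have "0 < \<phi> s 0" "\<phi> (s \<otimes>\<^bsub>G\<^esub> s) 0 < \<phi> (g0 \<otimes>\<^bsub>G\<^esub> s \<otimes>\<^bsub>G\<^esub> inv\<^bsub>G\<^esub> g0) 0"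
      using \<phi> by (simp_all add: U_def)
    moreover have "(\<exists>m::nat. \<phi> (inv\<^bsub>G\<^esub> s [^]\<^bsub>G\<^esub> m) 0 < \<phi> f 0) \<and> (\<exists>m::nat. \<phi> f 0 < \<phi> (s [^]\<^bsub>G\<^esub> m) 0)"
      if "g \<in> S" "f \<in> {g, g \<otimes>\<^bsub>G\<^esub> s \<otimes>\<^bsub>G\<^esub> inv\<^bsub>G\<^esub> g, g \<otimes>\<^bsub>G\<^esub> inv\<^bsub>G\<^esub> s \<otimes>\<^bsub>G\<^esub> inv\<^bsub>G\<^esub> g}" for g f
    proof -
      have "f \<in> F" using that by (auto simp: F_def)
      with \<phi> have "\<phi> \<in> B f" by (auto simp: U_def)
      then show ?thesis by (simp add: B_def)
    qed
    ultimately obtain \<psi> where "nonabelian_affine_action G \<psi>" "semi_conjugate G \<phi> \<psi>"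
      using expanded_translation_imp_affine[OF assms(1) irr _ s _ g0 _ S(2) gen S(3)] by metis
    with irr show "\<phi> \<in> ?A" by blast
  qed
  ultimately show "\<exists>T. openin (Hom_irr_topology G) T \<and> \<phi>0 \<in> T \<and> T \<subseteq> ?A"
    by blast
qed

end
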